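(* Let $n\geqslant1$, let $p_1,p_2\geqslant 1$ be integers, and let $\mathbf f_i:(\mathbb C^{2+n},0)\to(\mathbb C^n,0)$, $i=1,2$, be germs of holomorphic maps in the variables $(x_1,x_2,y)$, $y=(y_1,\ldots,y_n)^{\top}$. Let $\varphi\in\mathbb C[[x_1,x_2]]^n$ be a formal power series solution (without constant term) of the system $$x_1^{p_1}\,\frac{\partial y}{\partial x_1}=\mathbf f_1(x_1,x_2,y),\qquad x_2^{p_2}\,\frac{\partial y}{\partial x_2}=\mathbf f_2(x_1,x_2,y).$$ If the Jacobi matrices $\partial\mathbf f_i/\partial y$ on $\varphi$ satisfy $$\mathrm{ord}_{x_i}\frac{\partial\mathbf f_i}{\partial y}(x_1,x_2,\varphi)\geqslant p_i-1,\qquad i=1,2,$$ then the series $\varphi$ converges near $0\in\mathbb C^2$.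
   Context: A formal power series solution of the system is a series $\varphi=\sum_{|k|>0}\mathbf c_k x^k\in\mathbb C[[x_1,x_2]]^n$, with $\mathbf c_k\in\mathbb C^n$, $k\in\mathbb Z_+^2$, $|k|=k_1+k_2$, $x^k=x_1^{k_1}x_2^{k_2}$ (so without constant term), such that $x_i^{p_i}\,\partial\varphi/\partial x_i=\mathbf f_i(x_1,x_2,\varphi)$ in $\mathbb C[[x_1,x_2]]^n$ for $i=1,2$. Substitution of $y=\varphi$ means formal substitution into the Taylor series at the origin. For a matrix $f\in\mathrm{Mat}(n,\mathbb C[[x_1,x_2]])$ and $p\in\mathbb Z_+$, one writes $\mathrm{ord}_{x_i}f\geqslant p$ if $f=x_i^p\,g$ for some $g\in\mathrm{Mat}(n,\mathbb C[[x_1,x_2]])$. No integrability of the system is assumed. *)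

theory Defs
  imports "HOL-Analysis.Analysis" "HOL-Computational_Algebra.Formal_Power_Series"
begin

text \<open>
  The ring \<open>\<complex>[[x\<^sub>1,x\<^sub>2]]\<close> is rendered as \<open>\<complex>[[x\<^sub>2]][[x\<^sub>1]]\<close>: the outer variable is
  \<open>x\<^sub>1\<close>, and the coefficient of \<open>x\<^sub>1^i x\<^sub>2^j\<close> in \<open>F\<close> is \<open>fps_nth (fps_nth F i) j\<close>.
\<close>

type_synonym series2 = "complex fps fps"

definition coeff2 :: "series2 \<Rightarrow> nat \<Rightarrow> nat \<Rightarrow> complex"
  where "coeff2 F i j = fps_nth (fps_nth F i) j"

definition X1 :: series2
  where "X1 = fps_X"

definition X2 :: series2
  where "X2 = fps_const fps_X"

definition deriv_x1 :: "series2 \<Rightarrow> series2"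
  where "deriv_x1 F = fps_deriv F"

definition deriv_x2 :: "series2 \<Rightarrow> series2"
  where "deriv_x2 F = Abs_fps (\<lambda>i. fps_deriv (fps_nth F i))"

text \<open>
  Points of \<open>\<complex>^(2+n)\<close> are vectors indexed by the sum type \<open>2 + 'n\<close>: \<open>Inl 1\<close> and \<open>Inl 2\<close>
  are the positions of \<open>x\<^sub>1\<close> and \<open>x\<^sub>2\<close> (note that \<open>2 = 0\<close> in the two-element type \<open>2\<close>),
  and \<open>Inr j\<close> is the position of \<open>y\<^sub>j\<close>.

  A map is holomorphic near the origin if it is complex differentiable at every point of a
  neighbourhood of it; \<open>\<complex>\<close>-linearity of the Frechet derivative is expressed by requiring
  it to be given by a complex matrix.
\<close>

definition holomorphic_near_0 :: "(complex ^ 'm::finite \<Rightarrow> complex ^ 'n::finite) \<Rightarrow> bool"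
  where "holomorphic_near_0 f \<longleftrightarrow>
    (\<exists>U. open U \<and> 0 \<in> U \<and>
      (\<forall>z\<in>U. \<exists>A :: complex ^ 'm ^ 'n. (f has_derivative (\<lambda>h. A *v h)) (at z)))"

definition partial :: "'m::finite \<Rightarrow> (complex ^ 'm \<Rightarrow> complex) \<Rightarrow> complex ^ 'm \<Rightarrow> complex"
  where "partial k F z = deriv (\<lambda>t. F (z + axis k t)) 0"

text \<open>
  The iterated partial derivative for a multi-index \<open>\<alpha>\<close>, taken along an arbitrary enumeration
  of the variables. For \<open>F\<close> holomorphic near \<open>0\<close> partial derivatives commute near \<open>0\<close>,
  so the enumeration is immaterial.
\<close>

definition mixed_partial ::
    "('m::finite \<Rightarrow> nat) \<Rightarrow> (complex ^ 'm \<Rightarrow> complex) \<Rightarrow> complex ^ 'm \<Rightarrow> complex"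
  where "mixed_partial \<alpha> F =
    fold (\<lambda>k. partial k ^^ \<alpha> k) (SOME ks. distinct ks \<and> set ks = UNIV) F"

definition taylor_coeff :: "(complex ^ 'm::finite \<Rightarrow> complex) \<Rightarrow> ('m \<Rightarrow> nat) \<Rightarrow> complex"
  where "taylor_coeff F \<alpha> = mixed_partial \<alpha> F 0 / (\<Prod>k\<in>UNIV. fact (\<alpha> k))"

text \<open>
  Formal substitution of a family \<open>\<Phi>\<close> of series without constant term into the power series
  \<open>\<Sum>\<^sub>\<alpha> a\<^sub>\<alpha> z^\<alpha>\<close>. The coefficient of \<open>x\<^sub>1^i x\<^sub>2^j\<close> only receives contributions from the
  finitely many \<open>\<alpha>\<close> with \<open>\<bar>\<alpha>\<bar> \<le> i + j\<close>; see the two lemmas below.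
\<close>

definition formal_subst :: "(('m::finite \<Rightarrow> nat) \<Rightarrow> complex) \<Rightarrow> ('m \<Rightarrow> series2) \<Rightarrow> series2"
  where "formal_subst a \<Phi> =
    Abs_fps (\<lambda>i. Abs_fps (\<lambda>j.
      \<Sum>\<alpha> | (\<Sum>k\<in>UNIV. \<alpha> k) \<le> i + j. a \<alpha> * coeff2 (\<Prod>k\<in>UNIV. \<Phi> k ^ \<alpha> k) i j))"

lemma finite_bounded_multi_indices:
  "finite {\<alpha> :: 'm::finite \<Rightarrow> nat. (\<Sum>k\<in>UNIV. \<alpha> k) \<le> N}"
proof (rule finite_subset)
  have "\<alpha> k \<le> N" if "(\<Sum>k\<in>UNIV. \<alpha> k) \<le> N" for \<alpha> :: "'m \<Rightarrow> nat" and k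
    using member_le_sum[of k UNIV \<alpha>] that by simp
  then show "{\<alpha> :: 'm \<Rightarrow> nat. (\<Sum>k\<in>UNIV. \<alpha> k) \<le> N} \<subseteq> (\<Pi>\<^sub>E k\<in>UNIV. {..N})"
    by auto
  show "finite (\<Pi>\<^sub>E k\<in>(UNIV :: 'm set). {..N})"
    by (simp add: finite_PiE)
qed

lemma coeff2_prod_power_eq_0:
  fixes \<Phi> :: "'m::finite \<Rightarrow> series2"
  assumes "\<And>k. coeff2 (\<Phi> k) 0 0 = 0" and "i + j < (\<Sum>k\<in>UNIV. \<alpha> k)"
  shows "coeff2 (\<Prod>k\<in>UNIV. \<Phi> k ^ \<alpha> k) i j = 0"
proof -
  define P where "P d F \<longleftrightarrow> (\<forall>i j. i + j < d \<longrightarrow> coeff2 F i j = 0)" for d :: nat and F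
  have mult: "P (d + e) (F * G)" if "P d F" "P e G" for d e F G
    unfolding P_def
  proof (intro allI impI)
    fix i j :: nat
    assume ij: "i + j < d + e"
    have "coeff2 F r s * coeff2 G (i - r) (j - s) = 0" if "r \<le> i" "s \<le> j" for r s
    proof (cases "r + s < d")
      case True
      then show ?thesis using \<open>P d F\<close> by (simp add: P_def)
    next
      case False
      then have "(i - r) + (j - s) < e" using ij that by linarith
      then show ?thesis using \<open>P e G\<close> by (simp add: P_def)
    qed
    then show "coeff2 (F * G) i j = 0"
      by (auto simp: coeff2_def fps_mult_nth fps_sum_nth intro!: sum.neutral)
  qed
  have one: "P 0 F" for F by (simp add: P_def)
  have pow: "P m (\<Phi> k ^ m)" for k m
  proof (induction m)
    case 0
    then show ?case by (simp add: one)
  next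
    case (Suc m)
    have "P 1 (\<Phi> k)" using assms(1) by (simp add: P_def)
    from mult[OF this Suc] show ?case by simp
  qed
  have "P (\<Sum>k\<in>A. \<alpha> k) (\<Prod>k\<in>A. \<Phi> k ^ \<alpha> k)" if "finite A" for A
    using that by (induction A) (simp_all add: one mult pow)
  from this[of UNIV] show ?thesis using assms(2) by (simp add: P_def)
qed

text \<open>The substitution \<open>(x\<^sub>1, x\<^sub>2, y) \<mapsto> (x\<^sub>1, x\<^sub>2, \<phi>)\<close>.\<close>

definition point_on :: "series2 ^ 'n::finite \<Rightarrow> 2 + 'n \<Rightarrow> series2"
  where "point_on \<phi> k =
    (case k of Inl i \<Rightarrow> if i = 1 then X1 else X2 | Inr j \<Rightarrow> \<phi> $ j)"

definition taylor_on ::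
    "(complex ^ (2 + 'n::finite) \<Rightarrow> complex) \<Rightarrow> series2 ^ 'n \<Rightarrow> series2"
  where "taylor_on F \<phi> = formal_subst (taylor_coeff F) (point_on \<phi>)"

definition formal_solution ::
    "nat \<Rightarrow> nat \<Rightarrow> (complex ^ (2 + 'n::finite) \<Rightarrow> complex ^ 'n) \<Rightarrow>
      (complex ^ (2 + 'n) \<Rightarrow> complex ^ 'n) \<Rightarrow> series2 ^ 'n \<Rightarrow> bool"
  where "formal_solution p1 p2 f1 f2 \<phi> \<longleftrightarrow>
    (\<forall>j. coeff2 (\<phi> $ j) 0 0 = 0) \<and>
    (\<forall>j. X1 ^ p1 * deriv_x1 (\<phi> $ j) = taylor_on (\<lambda>z. f1 z $ j) \<phi>) \<and>
    (\<forall>j. X2 ^ p2 * deriv_x2 (\<phi> $ j) = taylor_on (\<lambda>z. f2 z $ j) \<phi>)"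

definition jacobian_on ::
    "(complex ^ (2 + 'n::finite) \<Rightarrow> complex ^ 'n) \<Rightarrow> series2 ^ 'n \<Rightarrow> series2 ^ 'n ^ 'n"
  where "jacobian_on f \<phi> = (\<chi> a b. taylor_on (partial (Inr b) (\<lambda>z. f z $ a)) \<phi>)"

text \<open>\<open>ord_ge X p M\<close>, for \<open>X\<close> one of the variables, says that \<open>M\<close> has order at least \<open>p\<close> in \<open>X\<close>.\<close>

definition ord_ge :: "series2 \<Rightarrow> nat \<Rightarrow> series2 ^ 'n ^ 'n \<Rightarrow> bool"
  where "ord_ge X p M \<longleftrightarrow> (\<exists>G :: series2 ^ 'n ^ 'n. M = (\<chi> a b. X ^ p * G $ a $ b))"

definition converges_near_0 :: "series2 ^ 'n::finite \<Rightarrow> bool"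
  where "converges_near_0 \<phi> \<longleftrightarrow>
    (\<exists>r>0. \<forall>x1 x2. norm x1 < r \<and> norm x2 < r \<longrightarrow>
      (\<forall>j. (\<lambda>(k1, k2). coeff2 (\<phi> $ j) k1 k2 * x1 ^ k1 * x2 ^ k2) summable_on UNIV))"

end

theory Submission
  imports Defs "HOL-Complex_Analysis.Cauchy_Integral_Formula"
begin

text \<open>
  The order condition says that the linearization of each equation along \<open>\<phi>\<close> has at most a regular
  singularity.  The two equations are used one after the other.

  Consider one equation \<open>x\<^sub>1^p \<partial>\<phi>/\<partial>x\<^sub>1 = f(x, \<phi>)\<close> whose Jacobi matrix on \<open>\<phi>\<close> is \<open>x\<^sub>1^(p-1) B\<close>.  Splitting off
  the part of \<open>\<phi>\<close> of order below \<open>N\<close> in \<open>x\<^sub>1\<close>, \<open>\<phi> = P + x\<^sub>1^N \<psi>\<close>, and dividing by \<open>x\<^sub>1^(N+p-1)\<close> leads to the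
  Briot--Bouquet equation \<open>(N + x\<^sub>1 \<partial>/\<partial>x\<^sub>1) \<psi> = g + B \<psi> + O(x\<^sub>1 \<psi>\<^sup>2)\<close>.  For large \<open>N\<close> the operator on the left
  dominates \<open>B\<close>, and \<open>\<psi>\<close> is bounded in terms of \<open>P\<close>.  This is an estimate in the weighted norms
  \<open>\<Sum> \<bar>c\<^sub>i\<^sub>j\<bar> s^(i+j)\<close>, taken over boxes of indices \<open>(i, j)\<close> and uniform in the size of the box; see
  \<open>formal_solution_bounded\<close>, which rests on the second order expansion \<open>formal_subst_taylor\<close>.

  Convergence of \<open>\<phi>\<close> is thus reduced to that of finitely many of its coefficients
  \<open>\<phi>\<^sub>i \<in> \<complex>[[x\<^sub>2]]^n\<close> as a series in \<open>x\<^sub>1\<close>.  These come from the second equation, with the roles of the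
  variables exchanged and modulo \<open>x\<^sub>1^M\<close>: there the same estimate applies, and the part of low order in
  \<open>x\<^sub>2\<close> consists of finitely many numbers.

  The analytic input on \<open>f\<^sub>1\<close> and \<open>f\<^sub>2\<close> consists of Cauchy's estimates for the Taylor coefficients and of the
  compatibility of Taylor expansion with partial differentiation, including the symmetry of mixed
  derivatives.  Both are obtained from the one-variable Cauchy formula
  (\<open>taylor_coeff_bound\<close>, \<open>taylor_coeff_partial\<close>).
\<close>

section \<open>Separately holomorphic functions on a polydisc\<close>

definition polydisc :: "real \<Rightarrow> (complex ^ 'm::finite) set"
  where "polydisc R = {z. \<forall>k. norm (z $ k) < R}"

text \<open>Holomorphy in several variables in Osgood's form.  It passes to partial derivatives by
  one-variable arguments alone, since Cauchy's formula in one variable expresses a partial derivative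
  as an integral of the function itself.\<close>

definition sep_holomorphic :: "real \<Rightarrow> (complex ^ 'm::finite \<Rightarrow> complex) \<Rightarrow> bool"
  where "sep_holomorphic R F \<longleftrightarrow> continuous_on (polydisc R) F \<and>
    (\<forall>z\<in>polydisc R. \<forall>k. (\<lambda>t. F (z + axis k t)) field_differentiable at 0)"

lemma open_polydisc: "open (polydisc R)"
proof -
  have "polydisc R = (\<Inter>k. (\<lambda>z. z $ k) -` ball 0 R)"
    by (auto simp: polydisc_def)
  also have "open \<dots>"
    by (intro open_INT ballI open_vimage_vec_nth) auto
  finally show ?thesis .
qed

lemma polydiscD: "z \<in> polydisc R \<Longrightarrow> norm (z $ k) < R"
  by (simp add: polydisc_def)

lemma polydisc_mono: "r \<le> R \<Longrightarrow> polydisc r \<subseteq> polydisc R"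
  by (auto simp: polydisc_def intro: less_le_trans)

lemma polydisc_exhaust:
  assumes "z \<in> polydisc R"
  obtains R' where "R' < R" "z \<in> polydisc R'"
proof -
  have bd: "norm (z $ k) < R" for k using assms by (simp add: polydisc_def)
  define m where "m = Max (range (\<lambda>k. norm (z $ k)))"
  have le: "norm (z $ k) \<le> m" for k unfolding m_def by (rule Max_ge) auto
  have "m \<in> range (\<lambda>k. norm (z $ k))" unfolding m_def by (rule Max_in) auto
  then have "m < R" "0 \<le> m" using bd by auto
  then show ?thesis
    using le_less_trans[OF le, of "(m + R) / 2"]
    by (intro that[of "(m + R) / 2"]) (auto simp: polydisc_def)
qed

lemma axis_add: "axis k (s + t) = axis k s + (axis k t :: complex ^ 'm::finite)"
  by (simp add: axis_def vec_eq_iff)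

lemma polydisc_add_axis:
  assumes "z \<in> polydisc r" "norm (z $ k + t) < R" "r \<le> R"
  shows "z + axis k t \<in> polydisc R"
  using assms by (auto simp: polydisc_def axis_def intro: less_le_trans)

lemma axis_zero: "axis k 0 = (0 :: complex ^ 'm::finite)"
  by (simp add: axis_def vec_eq_iff)

lemma linear_axis: "linear (axis k :: complex \<Rightarrow> complex ^ 'm::finite)"
  by (rule linearI) (simp_all add: axis_def vec_eq_iff)

lemma continuous_on_axis [continuous_intros]:
  "continuous_on S f \<Longrightarrow> continuous_on S (\<lambda>x. axis k (f x) :: complex ^ 'm::finite)"
  by (rule bounded_linear.continuous_on[OF linear_axis[unfolded linear_conv_bounded_linear]])

lemma sep_holomorphic_has_partial:
  assumes "sep_holomorphic R F" and "z + axis k w \<in> polydisc R"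
  shows "((\<lambda>t. F (z + axis k t)) has_field_derivative partial k F (z + axis k w)) (at w)"
proof -
  have "(\<lambda>t. F (z + axis k w + axis k t)) field_differentiable at 0"
    using assms by (auto simp: sep_holomorphic_def)
  then have "((\<lambda>t. F (z + axis k w + axis k t)) has_field_derivative
      partial k F (z + axis k w)) (at 0)"
    unfolding partial_def by (rule field_differentiable_derivI)
  moreover have "z + axis k w + axis k t = z + axis k (t + w)" for t
    by (simp add: axis_add add_ac)
  ultimately have "((\<lambda>t. F (z + axis k (t + w))) has_field_derivative
      partial k F (z + axis k w)) (at 0)" by simp
  then have "((\<lambda>t. F (z + axis k t)) has_field_derivative partial k F (z + axis k w)) (at (0 + w))"
    by (rule iffD2[OF DERIV_shift])
  then show ?thesis by simp
qed

lemma sep_holomorphic_subset: "sep_holomorphic R F \<Longrightarrow> r \<le> R \<Longrightarrow> sep_holomorphic r F"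
  unfolding sep_holomorphic_def
  using polydisc_mono[of r R] continuous_on_subset[of "polydisc R" F "polydisc r"] by auto

lemma deriv_eq_circle_integral:
  assumes "g holomorphic_on ball 0 R" "0 < r" "r < R"
  shows "deriv g 0 = integral {0..2*pi} (\<lambda>\<theta>. g (r * cis \<theta>) * (cis (-\<theta>) / (2 * pi * r)))"
proof -
  have "cball 0 r \<subseteq> ball (0::complex) R" using assms by auto
  then have "continuous_on (cball 0 r) g" "g holomorphic_on ball 0 r"
    using assms(1) holomorphic_on_imp_continuous_on holomorphic_on_subset ball_subset_cball
    by (meson continuous_on_subset, blast)
  from Cauchy_has_contour_integral_higher_derivative_circlepath[OF this, of 0 1]
  have "((\<lambda>u. g u / u ^ 2) has_contour_integral 2 * pi * \<i> * deriv g 0) (circlepath 0 r)"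
    using assms(2) by (simp add: numeral_2_eq_2)
  then have "((\<lambda>t. g (r * cis t) / (r * cis t) ^ 2 * r * \<i> * cis t) has_integral
      2 * pi * \<i> * deriv g 0) {0..2*pi}"
    by (simp add: circlepath_def has_contour_integral_part_circlepath_iff)
  then have "((\<lambda>t. 1 / (2 * pi * \<i>) * (g (r * cis t) / (r * cis t) ^ 2 * r * \<i> * cis t)) has_integral
      1 / (2 * pi * \<i>) * (2 * pi * \<i> * deriv g 0)) {0..2*pi}"
    by (rule has_integral_mult_right)
  moreover have "1 / (2 * pi * \<i>) * (g (r * cis t) / (r * cis t) ^ 2 * r * \<i> * cis t) =
      g (r * cis t) * (cis (-t) / (2 * pi * r))" for t
    using assms(2) by (simp add: cis_inverse[symmetric] field_simps power2_eq_square)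
  ultimately have "((\<lambda>t. g (r * cis t) * (cis (-t) / (2 * pi * r))) has_integral deriv g 0) {0..2*pi}"
    by simp
  then show ?thesis by (rule integral_unique[symmetric])
qed

text \<open>The radius \<open>R - R'\<close> is the same for all \<open>z\<close> of the smaller polydisc, so that the right-hand side
  is an integral over a fixed interval depending on the parameter \<open>z\<close>.\<close>

lemma partial_eq_circle_integral:
  assumes "sep_holomorphic R F" "z \<in> polydisc R'" "R' < R"
  shows "partial k F z = integral {0..2*pi}
    (\<lambda>\<theta>. F (z + axis k (complex_of_real (R - R') * cis \<theta>)) * (cis (-\<theta>) / (2 * pi * (R - R'))))"
  unfolding partial_def
proof (subst deriv_eq_circle_integral[where r = "R - R'" and R = "R - norm (z $ k)"])
  show "(\<lambda>t. F (z + axis k t)) holomorphic_on ball 0 (R - norm (z $ k))"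
    unfolding holomorphic_on_open[OF open_ball]
  proof
    fix t :: complex assume "t \<in> ball 0 (R - norm (z $ k))"
    then have "norm (z $ k + t) < R" by (smt (verit) mem_ball_0 norm_triangle_ineq)
    then have "z + axis k t \<in> polydisc R"
      using assms polydisc_add_axis by fastforce
    then show "\<exists>f'. ((\<lambda>t. F (z + axis k t)) has_field_derivative f') (at t)"
      using sep_holomorphic_has_partial[OF assms(1)] by blast
  qed
qed (use assms in \<open>auto simp: polydisc_def of_real_diff\<close>)

lemma polydisc_add_circle:
  assumes "z \<in> polydisc R'" "R' < R"
  shows "z + axis k (complex_of_real (R - R') * cis \<theta>) \<in> polydisc R"
proof (rule polydisc_add_axis[OF assms(1)])
  have "norm (z $ k + complex_of_real (R - R') * cis \<theta>) \<le> norm (z $ k) + (R - R')"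
    using norm_triangle_ineq[of "z $ k" "complex_of_real (R - R') * cis \<theta>"] assms(2)
    by (simp add: norm_mult del: of_real_diff)
  also have "\<dots> < R" using assms(1) by (simp add: polydisc_def)
  finally show "norm (z $ k + complex_of_real (R - R') * cis \<theta>) < R" .
qed (use assms in simp)

lemma continuous_on_circle_shift:
  fixes F :: "complex ^ 'm::finite \<Rightarrow> complex"
  assumes "continuous_on (polydisc R) F" "R' < R"
    and "continuous_on S f" "continuous_on S \<theta>" "f ` S \<subseteq> polydisc R'"
  shows "continuous_on S (\<lambda>x. F (f x + axis k (complex_of_real (R - R') * cis (\<theta> x))) *
    (cis (- \<theta> x) / (2 * pi * (R - R'))))"
  using assms
  by (intro continuous_intros continuous_on_compose2[OF assms(1)])
     (auto intro!: polydisc_add_circle simp del: of_real_diff)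

lemma continuous_on_partial:
  assumes F: "sep_holomorphic R F"
  shows "continuous_on (polydisc R) (partial k F)"
  unfolding continuous_on_eq_continuous_at[OF open_polydisc]
proof
  fix z :: "complex ^ 'a" assume "z \<in> polydisc R"
  then obtain r where r: "r < R" "z \<in> polydisc r" by (rule polydisc_exhaust)
  let ?h = "\<lambda>z \<theta>. F (z + axis k (complex_of_real (R - r) * cis \<theta>)) *
    (cis (-\<theta>) / (2 * pi * (R - r)))"
  have "continuous_on (polydisc r) (\<lambda>z. integral (cbox 0 (2*pi)) (?h z))"
  proof (rule integral_continuous_on_param)
    show "continuous_on (polydisc r \<times> cbox 0 (2*pi)) (\<lambda>(z, \<theta>). ?h z \<theta>)"
      unfolding split_beta using F r
      by (intro continuous_on_circle_shift) (auto simp: sep_holomorphic_def intro!: continuous_intros)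
  qed
  then have "continuous_on (polydisc r) (partial k F)"
    by (rule continuous_on_eq) (use partial_eq_circle_integral[OF F _ r(1)] in auto)
  then show "isCont (partial k F) z"
    using r continuous_on_eq_continuous_at[OF open_polydisc] by auto
qed

text \<open>Differentiating Cauchy's formula for \<open>\<partial>\<^sub>k F\<close> under the integral sign in direction \<open>j\<close>.  The
  existence of this derivative makes \<open>\<partial>\<^sub>k F\<close> separately holomorphic; the integral then turns out to be
  Cauchy's formula for \<open>\<partial>\<^sub>k (\<partial>\<^sub>j F)\<close>, so that partial derivatives commute.\<close>

lemma partial_has_partial_integral:
  assumes F: "sep_holomorphic R F" and r: "r < R" "z \<in> polydisc r"
  shows "((\<lambda>t. partial k F (z + axis j t)) has_field_derivative integral {0..2*pi}
    (\<lambda>\<theta>. partial j F (z + axis k (complex_of_real (R - r) * cis \<theta>)) * (cis (-\<theta>) / (2 * pi * (R - r))))) (at 0)"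
proof -
  obtain r' where r': "r' < r" "z \<in> polydisc r'" using r(2) by (rule polydisc_exhaust)
  let ?e = "\<lambda>\<theta>. axis k (complex_of_real (R - r) * cis \<theta>)"
  let ?c = "\<lambda>\<theta>. cis (-\<theta>) / (2 * pi * (R - r))"
  let ?U = "ball (0::complex) (r - r')"
  have U: "z + axis j t \<in> polydisc r" if "t \<in> ?U" for t
  proof (rule polydisc_add_axis[OF r'(2)])
    show "norm (z $ j + t) < r"
      using norm_triangle_ineq[of "z $ j" t] polydiscD[OF r'(2), of j] that by simp
  qed (use r' in simp)
  have "((\<lambda>t. integral (cbox 0 (2*pi)) (\<lambda>\<theta>. F (z + axis j t + ?e \<theta>) * ?c \<theta>)) has_field_derivative
      integral (cbox 0 (2*pi)) (\<lambda>\<theta>. partial j F (z + axis j 0 + ?e \<theta>) * ?c \<theta>)) (at 0 within ?U)"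
  proof (rule leibniz_rule_field_derivative)
    fix t :: complex and \<theta> :: real assume t: "t \<in> ?U"
    have "z + ?e \<theta> + axis j t \<in> polydisc R"
      using polydisc_add_circle[OF U[OF t] r(1)] by (simp add: add_ac del: of_real_diff)
    from sep_holomorphic_has_partial[OF F this]
    have "((\<lambda>t. F (z + axis j t + ?e \<theta>)) has_field_derivative partial j F (z + axis j t + ?e \<theta>)) (at t)"
      by (simp add: add_ac del: of_real_diff)
    then show "((\<lambda>t. F (z + axis j t + ?e \<theta>) * ?c \<theta>) has_field_derivative
        partial j F (z + axis j t + ?e \<theta>) * ?c \<theta>) (at t within ?U)"
      by (intro DERIV_cmult_right) (rule has_field_derivative_at_within)
  next
    fix t :: complex assume t: "t \<in> ?U"
    show "(\<lambda>\<theta>. F (z + axis j t + ?e \<theta>) * ?c \<theta>) integrable_on cbox 0 (2*pi)"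
      using F r U[OF t]
      by (intro integrable_continuous continuous_on_circle_shift)
         (auto simp: sep_holomorphic_def intro!: continuous_intros)
  next
    show "continuous_on (?U \<times> cbox 0 (2*pi)) (\<lambda>(t, \<theta>). partial j F (z + axis j t + ?e \<theta>) * ?c \<theta>)"
      unfolding split_beta using continuous_on_partial[OF F] r U
      by (intro continuous_on_circle_shift) (auto intro!: continuous_intros simp del: mem_ball)
  qed (use r' in auto)
  then have "((\<lambda>t. integral (cbox 0 (2*pi)) (\<lambda>\<theta>. F (z + axis j t + ?e \<theta>) * ?c \<theta>)) has_field_derivative
      integral {0..2*pi} (\<lambda>\<theta>. partial j F (z + ?e \<theta>) * ?c \<theta>)) (at 0)"
    using r' by (simp add: at_within_open[of 0 ?U] axis_zero del: of_real_diff)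
  then show ?thesis
  proof (rule has_field_derivative_transform_within_open[of _ _ _ ?U])
    fix t assume "t \<in> ?U"
    then show "integral (cbox 0 (2*pi)) (\<lambda>\<theta>. F (z + axis j t + ?e \<theta>) * ?c \<theta>) =
        partial k F (z + axis j t)"
      using partial_eq_circle_integral[OF F U r(1)] by simp
  qed (use r' in auto)
qed

lemma sep_holomorphic_partial:
  assumes "sep_holomorphic R F"
  shows "sep_holomorphic R (partial k F)"
  unfolding sep_holomorphic_def
proof (intro conjI ballI allI)
  fix z :: "complex ^ 'a" and j assume "z \<in> polydisc R"
  then obtain r where r: "r < R" "z \<in> polydisc r" by (rule polydisc_exhaust)
  then show "(\<lambda>t. partial k F (z + axis j t)) field_differentiable at 0"
    using partial_has_partial_integral[OF assms] unfolding field_differentiable_def by blast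
qed (rule continuous_on_partial[OF assms])

lemma partial_commute:
  assumes "sep_holomorphic R F" "z \<in> polydisc R"
  shows "partial j (partial k F) z = partial k (partial j F) z"
proof -
  obtain r where r: "r < R" "z \<in> polydisc r" using assms(2) by (rule polydisc_exhaust)
  have "partial j (partial k F) z = integral {0..2*pi}
      (\<lambda>\<theta>. partial j F (z + axis k (complex_of_real (R - r) * cis \<theta>)) * (cis (-\<theta>) / (2 * pi * (R - r))))"
    unfolding partial_def[of j "partial k F"]
    using DERIV_imp_deriv[OF partial_has_partial_integral[OF assms(1) r, of k j]] by simp
  also have "\<dots> = partial k (partial j F) z"
    using partial_eq_circle_integral[OF sep_holomorphic_partial[OF assms(1)] r(2,1)] by simp
  finally show ?thesis .
qed

section \<open>Taylor coefficients\<close>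

lemma partial_cong:
  assumes "\<And>z. z \<in> polydisc R \<Longrightarrow> F z = G z" "z \<in> polydisc R"
  shows "partial k F z = partial k G z"
proof -
  have "continuous_on UNIV (\<lambda>t. z + axis k t)" by (intro continuous_intros)
  then have "open ((\<lambda>t. z + axis k t) -` polydisc R)"
    using open_vimage open_polydisc by blast
  then have "\<forall>\<^sub>F t in nhds 0. t \<in> (\<lambda>t. z + axis k t) -` polydisc R"
    by (rule eventually_nhds_in_open) (simp add: axis_zero assms)
  then show ?thesis unfolding partial_def
    by (intro deriv_cong_ev) (auto elim!: eventually_mono simp: assms(1))
qed

lemma funpow_partial_cong:
  assumes "\<And>z. z \<in> polydisc R \<Longrightarrow> F z = G z" "z \<in> polydisc R"
  shows "(partial k ^^ n) F z = (partial k ^^ n) G z"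
  using assms(2) by (induction n arbitrary: z) (auto intro: assms(1) partial_cong)

lemma fold_partial_cong:
  assumes "\<And>z. z \<in> polydisc R \<Longrightarrow> F z = G z" "z \<in> polydisc R"
  shows "fold (\<lambda>k. partial k ^^ \<alpha> k) ks F z = fold (\<lambda>k. partial k ^^ \<alpha> k) ks G z"
  using assms
proof (induction ks arbitrary: F G)
  case (Cons k ks)
  from Cons.IH[OF funpow_partial_cong[OF Cons.prems(1)]] Cons.prems(2) show ?case by simp
qed simp

lemma sep_holomorphic_funpow_partial:
  "sep_holomorphic R F \<Longrightarrow> sep_holomorphic R ((partial k ^^ n) F)"
  by (induction n) (auto intro: sep_holomorphic_partial)

lemma funpow_partial_commute:
  assumes "sep_holomorphic R F" "z \<in> polydisc R"
  shows "partial k ((partial h ^^ n) F) z = (partial h ^^ n) (partial k F) z"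
  using assms(2)
proof (induction n arbitrary: z)
  case (Suc n)
  have "partial k ((partial h ^^ Suc n) F) z = partial h (partial k ((partial h ^^ n) F)) z"
    using partial_commute[OF sep_holomorphic_funpow_partial[OF assms(1)]] Suc.prems by simp
  also have "\<dots> = partial h ((partial h ^^ n) (partial k F)) z"
    by (rule partial_cong[OF Suc.IH Suc.prems])
  finally show ?case by simp
qed simp

text \<open>An iterated derivative is taken along a fixed enumeration of the variables.  Since the partial
  derivatives commute, one more derivative in direction \<open>k\<close> may be taken first of all.\<close>

lemma fold_partial_Suc:
  assumes "sep_holomorphic R F" "z \<in> polydisc R" "distinct ks" "k \<in> set ks"
  shows "fold (\<lambda>h. partial h ^^ (\<alpha>(k := Suc (\<alpha> k))) h) ks F z =
    fold (\<lambda>h. partial h ^^ \<alpha> h) ks (partial k F) z"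
  using assms
proof (induction ks arbitrary: F)
  case (Cons h ks)
  let ?F = "(partial h ^^ \<alpha> h) F"
  show ?case
  proof (cases "h = k")
    case True
    have "fold (\<lambda>h. partial h ^^ (\<alpha>(k := Suc (\<alpha> k))) h) ks = fold (\<lambda>h. partial h ^^ \<alpha> h) ks"
      using Cons.prems True by (intro ext fold_cong) auto
    then show ?thesis using True by (simp add: funpow_swap1)
  next
    case False
    then have "fold (\<lambda>h. partial h ^^ (\<alpha>(k := Suc (\<alpha> k))) h) (h # ks) F z =
        fold (\<lambda>h. partial h ^^ \<alpha> h) ks (partial k ?F) z"
      using Cons.IH[OF sep_holomorphic_funpow_partial] Cons.prems by simp
    also have "\<dots> = fold (\<lambda>h. partial h ^^ \<alpha> h) ks ((partial h ^^ \<alpha> h) (partial k F)) z"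
      using funpow_partial_commute[OF Cons.prems(1)] Cons.prems(2) by (rule fold_partial_cong)
    finally show ?thesis by simp
  qed
qed simp

lemma enumeration_of_UNIV:
  "distinct (SOME ks :: 'm::finite list. distinct ks \<and> set ks = UNIV) \<and>
    set (SOME ks :: 'm::finite list. distinct ks \<and> set ks = UNIV) = UNIV"
  by (rule someI_ex) (use finite_distinct_list[of "UNIV :: 'm set"] in auto)

lemma taylor_coeff_partial:
  assumes "sep_holomorphic R F" "0 < R"
  shows "taylor_coeff (partial k F) \<alpha> =
    of_nat (Suc (\<alpha> k)) * taylor_coeff F (\<alpha>(k := Suc (\<alpha> k)))"
proof -
  have "mixed_partial (\<alpha>(k := Suc (\<alpha> k))) F 0 = mixed_partial \<alpha> (partial k F) 0"
    unfolding mixed_partial_def using assms(2) enumeration_of_UNIV[where 'm = 'a]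
    by (intro fold_partial_Suc[OF assms(1)]) (auto simp: polydisc_def)
  moreover have "(\<Prod>h\<in>UNIV. fact ((\<alpha>(k := Suc (\<alpha> k))) h) :: complex) =
      of_nat (Suc (\<alpha> k)) * (\<Prod>h\<in>UNIV. fact (\<alpha> h))"
    by (simp add: prod.remove[of UNIV k] del: of_nat_Suc) 
  ultimately show ?thesis
    unfolding taylor_coeff_def by (simp add: field_simps del: of_nat_Suc)
qed

lemma higher_deriv_axis:
  assumes "sep_holomorphic R F" "z + axis k w \<in> polydisc R"
  shows "(deriv ^^ n) (\<lambda>t. F (z + axis k t)) w = (partial k ^^ n) F (z + axis k w)"
  using assms(2)
proof (induction n arbitrary: w)
  case (Suc n)
  let ?V = "(\<lambda>t. z + axis k t) -` polydisc R"
  have "continuous_on UNIV (\<lambda>t. z + axis k t)" by (intro continuous_intros)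
  then have V: "open ?V" using open_vimage open_polydisc by blast
  have "((\<lambda>t. (partial k ^^ n) F (z + axis k t)) has_field_derivative
      partial k ((partial k ^^ n) F) (z + axis k w)) (at w)"
    using sep_holomorphic_has_partial[OF sep_holomorphic_funpow_partial[OF assms(1)] Suc.prems] .
  then have "((deriv ^^ n) (\<lambda>t. F (z + axis k t)) has_field_derivative
      partial k ((partial k ^^ n) F) (z + axis k w)) (at w)"
    by (rule has_field_derivative_transform_within_open[OF _ V]) (use Suc in auto)
  then show ?case by (simp add: DERIV_imp_deriv)
qed simp

lemma Cauchy_estimate_funpow_partial:
  assumes F: "sep_holomorphic (2 * R) F" and B: "\<And>z. z \<in> polydisc (2 * R) \<Longrightarrow> norm (F z) \<le> B"
    and z: "z \<in> polydisc R" and R: "0 < R"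
  shows "norm ((partial k ^^ n) F z) \<le> fact n * B / R ^ n"
proof -
  have in_disc: "z + axis k t \<in> polydisc (2 * R)" if "norm t \<le> R" for t
    using norm_triangle_ineq[of "z $ k" t] polydiscD[OF z, of k] that R
    by (intro polydisc_add_axis[OF z]) auto
  have der: "((\<lambda>t. F (z + axis k t)) has_field_derivative partial k F (z + axis k t)) (at t)"
    if "norm t \<le> R" for t
    using sep_holomorphic_has_partial[OF F in_disc[OF that]] .
  have "norm ((deriv ^^ n) (\<lambda>t. F (z + axis k t)) 0) \<le> fact n * B / R ^ n"
  proof (rule Cauchy_inequality)
    show "(\<lambda>t. F (z + axis k t)) holomorphic_on ball 0 R"
      unfolding holomorphic_on_open[OF open_ball] using der by (force simp: less_imp_le)
    show "continuous_on (cball 0 R) (\<lambda>t. F (z + axis k t))"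
      using der by (intro continuous_at_imp_continuous_on ballI DERIV_isCont) auto
  qed (use R B in_disc in auto)
  then show ?thesis
    using higher_deriv_axis[OF F in_disc[of 0]] R by (simp add: axis_zero)
qed

text \<open>The one-variable Cauchy estimate in direction \<open>k\<close> uses a circle on which the previously differentiated
  function is still bounded, so each variable costs half of the polyradius.\<close>

lemma Cauchy_estimate_fold_partial:
  assumes "sep_holomorphic (2 ^ length ks * \<rho>) F"
    and "\<And>z. z \<in> polydisc (2 ^ length ks * \<rho>) \<Longrightarrow> norm (F z) \<le> B"
    and "z \<in> polydisc \<rho>" and "0 < \<rho>"
  shows "norm (fold (\<lambda>k. partial k ^^ \<alpha> k) ks F z) \<le> B * (\<Prod>k\<leftarrow>ks. fact (\<alpha> k) / \<rho> ^ \<alpha> k)"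
  using assms
proof (induction ks arbitrary: F B)
  case (Cons k ks)
  let ?R = "2 ^ length ks * \<rho>"
  have R: "\<rho> \<le> ?R" "0 < ?R" using Cons.prems(4) by auto
  have F: "sep_holomorphic (2 * ?R) F" using Cons.prems(1) by (simp add: mult.assoc)
  have "norm (F 0) \<le> B" using Cons.prems(2)[of 0] Cons.prems(4) by (simp add: polydisc_def)
  then have B: "0 \<le> B" using norm_ge_zero[of "F 0"] by linarith
  have "norm (fold (\<lambda>k. partial k ^^ \<alpha> k) ks ((partial k ^^ \<alpha> k) F) z) \<le>
      (fact (\<alpha> k) * B / \<rho> ^ \<alpha> k) * (\<Prod>k\<leftarrow>ks. fact (\<alpha> k) / \<rho> ^ \<alpha> k)"
  proof (rule Cons.IH)
    show "sep_holomorphic ?R ((partial k ^^ \<alpha> k) F)"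
      using sep_holomorphic_funpow_partial[OF sep_holomorphic_subset[OF F, of ?R]] R Cons.prems(4) by simp
    fix w :: "complex ^ 'a" assume "w \<in> polydisc ?R"
    then have "norm ((partial k ^^ \<alpha> k) F w) \<le> fact (\<alpha> k) * B / ?R ^ \<alpha> k"
      using Cauchy_estimate_funpow_partial[OF F] Cons.prems(2) R by (simp add: mult.assoc)
    (* Replacing the actual radius ?R by the smallest one makes the bound a product over ks. *)
    also have "\<dots> \<le> fact (\<alpha> k) * B / \<rho> ^ \<alpha> k"
      using R B Cons.prems(4) by (intro divide_left_mono power_mono mult_pos_pos zero_less_power) auto
    finally show "norm ((partial k ^^ \<alpha> k) F w) \<le> fact (\<alpha> k) * B / \<rho> ^ \<alpha> k" .
  qed (use Cons.prems in auto)
  then show ?case by (simp add: field_simps)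
qed simp

lemma taylor_coeff_bound:
  fixes F :: "complex ^ 'm::finite \<Rightarrow> complex"
  assumes F: "sep_holomorphic R F" and B: "\<And>z. z \<in> polydisc R \<Longrightarrow> norm (F z) \<le> B" and "0 < R"
  shows "norm (taylor_coeff F \<alpha>) \<le> B / (R / 2 ^ CARD('m)) ^ (\<Sum>k\<in>UNIV. \<alpha> k)"
proof -
  define ks where "ks = (SOME ks :: 'm list. distinct ks \<and> set ks = UNIV)"
  have ks: "distinct ks" "set ks = UNIV"
    using enumeration_of_UNIV[where 'm = 'm] by (auto simp: ks_def)
  have len: "length ks = CARD('m)" using distinct_card[OF ks(1)] ks(2) by simp
  define \<rho> where "\<rho> = R / 2 ^ CARD('m)"
  have \<rho>: "0 < \<rho>" using assms(3) by (simp add: \<rho>_def)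
  have "norm (mixed_partial \<alpha> F 0) \<le> B * (\<Prod>k\<leftarrow>ks. fact (\<alpha> k) / \<rho> ^ \<alpha> k)"
    unfolding mixed_partial_def ks_def[symmetric]
    by (rule Cauchy_estimate_fold_partial) (use F B \<rho> in \<open>auto simp: \<rho>_def len polydisc_def\<close>)
  also have "(\<Prod>k\<leftarrow>ks. fact (\<alpha> k) / \<rho> ^ \<alpha> k) = (\<Prod>k\<in>UNIV. fact (\<alpha> k) / \<rho> ^ \<alpha> k)"
    using ks prod.distinct_set_conv_list by metis
  also have "\<dots> = (\<Prod>k\<in>UNIV. fact (\<alpha> k)) / \<rho> ^ (\<Sum>k\<in>UNIV. \<alpha> k)"
    by (simp add: prod_dividef power_sum)
  finally have "norm (mixed_partial \<alpha> F 0) \<le> B / \<rho> ^ (\<Sum>k\<in>UNIV. \<alpha> k) * (\<Prod>k\<in>UNIV. fact (\<alpha> k))"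
    by simp
  moreover have "0 < (\<Prod>k\<in>UNIV. fact (\<alpha> k) :: real)" by (intro prod_pos) auto
  ultimately show ?thesis
    unfolding taylor_coeff_def \<rho>_def[symmetric] by (simp add: norm_divide divide_le_eq flip: prod_norm)
qed

lemma holomorphic_near_0_imp_sep_holomorphic:
  fixes f :: "complex ^ 'm::finite \<Rightarrow> complex ^ 'n::finite"
  assumes "holomorphic_near_0 f"
  obtains R B where "0 < R" "\<And>j. sep_holomorphic R (\<lambda>z. f z $ j)"
    "\<And>j z. z \<in> polydisc R \<Longrightarrow> norm (f z $ j) \<le> B"
proof -
  from assms obtain U where U: "open U" "0 \<in> U"
    and der: "\<And>z. z \<in> U \<Longrightarrow> \<exists>A :: complex ^ 'm ^ 'n. (f has_derivative (\<lambda>h. A *v h)) (at z)"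
    unfolding holomorphic_near_0_def by blast
  have cont: "isCont f z" if "z \<in> U" for z
    using der[OF that] has_derivative_continuous by blast
  have "\<forall>\<^sub>F z in nhds 0. dist (f z) (f 0) < 1"
    using tendstoD[OF cont[OF U(2), unfolded isCont_def tendsto_at_iff_tendsto_nhds], of 1] by simp
  moreover have "\<forall>\<^sub>F z in nhds 0. z \<in> U" using U by (rule eventually_nhds_in_open)
  ultimately have "\<forall>\<^sub>F z in nhds 0. dist (f z) (f 0) < 1 \<and> z \<in> U" by eventually_elim simp
  then obtain e where e: "0 < e" "\<And>z. norm z < e \<Longrightarrow> dist (f z) (f 0) < 1 \<and> z \<in> U"
    unfolding eventually_nhds_metric by auto
  define R where "R = e / (2 * real CARD('m))"
  have R: "0 < R" using e by (simp add: R_def)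
  have small: "norm z < e" if "z \<in> polydisc R" for z :: "complex ^ 'm"
  proof -
    have "norm z \<le> (\<Sum>k\<in>UNIV. norm (z $ k))"
      unfolding norm_vec_def by (rule L2_set_le_sum) simp
    also have "\<dots> \<le> (\<Sum>k\<in>(UNIV :: 'm set). R)"
      using that by (intro sum_mono) (auto simp: polydisc_def intro: less_imp_le)
    also have "\<dots> < e" using e by (simp add: R_def)
    finally show ?thesis .
  qed
  show ?thesis
  proof (rule that[OF R])
    fix j and z :: "complex ^ 'm" assume "z \<in> polydisc R"
    then have "dist (f z) (f 0) < 1" using e small by blast
    then have "norm (f z) \<le> norm (f 0) + 1"
      using norm_triangle_sub[of "f z" "f 0"] by (simp add: dist_norm)
    then show "norm (f z $ j) \<le> norm (f 0) + 1"
      using Finite_Cartesian_Product.norm_nth_le[of "f z" j] by linarith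
  next
    fix j
    show "sep_holomorphic R (\<lambda>z. f z $ j)"
      unfolding sep_holomorphic_def
    proof (intro conjI ballI allI)
      show "continuous_on (polydisc R) (\<lambda>z. f z $ j)"
        using cont e small by (intro continuous_on_component continuous_at_imp_continuous_on) blast
    next
      fix z :: "complex ^ 'm" and k assume "z \<in> polydisc R"
      then obtain A :: "complex ^ 'm ^ 'n" where "(f has_derivative (\<lambda>h. A *v h)) (at z)"
        using der e small by blast
      then have A: "(f has_derivative (\<lambda>h. A *v h)) (at (z + axis k 0))" by (simp add: axis_zero)
      have "((\<lambda>t. z + axis k t) has_derivative (\<lambda>t. axis k t)) (at 0)"
        using has_derivative_add[OF has_derivative_const linear_imp_has_derivative[OF linear_axis]]
        by simp
      from has_derivative_compose[OF this A]
      have "((\<lambda>t. f (z + axis k t)) has_derivative (\<lambda>t. A *v axis k t)) (at 0)" .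
      then have "((\<lambda>t. f (z + axis k t) $ j) has_derivative (\<lambda>t. (A *v axis k t) $ j)) (at 0)"
        by (rule bounded_linear.has_derivative[OF bounded_linear_vec_nth])
      moreover have "(\<lambda>t. (A *v axis k t) $ j) = (\<lambda>t. A $ j $ k * t)"
        by (auto simp: matrix_vector_mult_def axis_def if_distrib cong: if_cong)
      ultimately have "((\<lambda>t. f (z + axis k t) $ j) has_field_derivative A $ j $ k) (at 0)"
        by (simp add: has_field_derivative_def)
      then show "(\<lambda>t. f (z + axis k t) $ j) field_differentiable at 0"
        unfolding field_differentiable_def by blast
    qed
  qed
qed

section \<open>Weighted truncated norms of double series\<close>

lemma series2_eqI: "(\<And>i j. coeff2 F i j = coeff2 G i j) \<Longrightarrow> F = G"
  by (simp add: fps_eq_iff coeff2_def)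

lemma coeff2_add [simp]: "coeff2 (F + G) i j = coeff2 F i j + coeff2 G i j"
  and coeff2_diff [simp]: "coeff2 (F - G) i j = coeff2 F i j - coeff2 G i j"
  and coeff2_zero [simp]: "coeff2 0 i j = 0"
  by (simp_all add: coeff2_def)

lemma coeff2_sum: "coeff2 (\<Sum>x\<in>A. F x) i j = (\<Sum>x\<in>A. coeff2 (F x) i j)"
  by (simp add: coeff2_def fps_sum_nth)

lemma coeff2_mult:
  "coeff2 (F * G) i j = (\<Sum>r\<le>i. \<Sum>l\<le>j. coeff2 F r l * coeff2 G (i - r) (j - l))"
  by (simp add: coeff2_def fps_mult_nth fps_sum_nth atLeast0AtMost)

lemma coeff2_X1_power_mult: "coeff2 (X1 ^ m * F) i j = (if i < m then 0 else coeff2 F (i - m) j)"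
  by (simp add: coeff2_def X1_def fps_X_power_mult_nth)

lemma coeff2_cutoff: "coeff2 (fps_cutoff N F) i j = (if i < N then coeff2 F i j else 0)"
  by (simp add: coeff2_def)

lemma coeff2_shift: "coeff2 (fps_shift N F) i j = coeff2 F (i + N) j"
  by (simp add: coeff2_def)

lemma coeff2_deriv_x1: "coeff2 (deriv_x1 F) i j = of_nat (Suc i) * coeff2 F (Suc i) j"
  by (simp add: coeff2_def deriv_x1_def mult_of_nat_commute del: of_nat_Suc flip: fps_of_nat)

lemma cutoff_add_shift: "fps_cutoff N F + X1 ^ N * fps_shift N F = (F :: series2)"
  by (intro series2_eqI) (auto simp: coeff2_cutoff coeff2_shift coeff2_X1_power_mult)

definition scalar :: "complex \<Rightarrow> series2"
  where "scalar c = fps_const (fps_const c)"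

lemma coeff2_scalar_mult [simp]: "coeff2 (scalar c * F) i j = c * coeff2 F i j"
  by (simp add: scalar_def coeff2_def)

lemma coeff2_scalar: "coeff2 (scalar c) i j = (if i = 0 \<and> j = 0 then c else 0)"
  by (simp add: scalar_def coeff2_def)

lemma scalar_mult: "scalar (a * b) = scalar a * scalar b"
  by (simp add: scalar_def)

lemma scalar_of_nat: "scalar (of_nat n) = of_nat n"
  by (simp add: scalar_def fps_of_nat)

text \<open>The weighted \<open>\<ell>\<^sup>1\<close>-norm of the coefficients, truncated to the box of the first \<open>I\<close> powers of \<open>x\<^sub>1\<close> and
  the first \<open>J\<close> powers of \<open>x\<^sub>2\<close>.  The truncation makes it finite on divergent series; convergence near
  the origin means that it is bounded in \<open>I\<close> and \<open>J\<close> for some radius \<open>s > 0\<close>.  Submultiplicativity survives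
  the truncation because the series vanishing on the box form an ideal.\<close>

definition wnorm :: "real \<Rightarrow> nat \<Rightarrow> nat \<Rightarrow> series2 \<Rightarrow> real"
  where "wnorm s I J F = (\<Sum>i<I. \<Sum>j<J. norm (coeff2 F i j) * s ^ (i + j))"

lemma wnorm_nonneg: "0 \<le> s \<Longrightarrow> 0 \<le> wnorm s I J F"
  unfolding wnorm_def by (intro sum_nonneg) auto

lemma wnorm_zero [simp]: "wnorm s I J 0 = 0"
  by (simp add: wnorm_def)

lemma wnorm_add: "0 \<le> s \<Longrightarrow> wnorm s I J (F + G) \<le> wnorm s I J F + wnorm s I J G"
  unfolding wnorm_def sum.distrib[symmetric]
  by (intro sum_mono) (auto simp: distrib_right[symmetric] intro!: mult_right_mono norm_triangle_ineq)

lemma wnorm_diff: "0 \<le> s \<Longrightarrow> wnorm s I J (F - G) \<le> wnorm s I J F + wnorm s I J G"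
  unfolding wnorm_def sum.distrib[symmetric]
  by (intro sum_mono) (auto simp: distrib_right[symmetric] intro!: mult_right_mono norm_triangle_ineq4)

lemma wnorm_sum: "0 \<le> s \<Longrightarrow> wnorm s I J (\<Sum>x\<in>A. F x) \<le> (\<Sum>x\<in>A. wnorm s I J (F x))"
proof (induction A rule: infinite_finite_induct)
  case (insert x A)
  then show ?case using wnorm_add[of s I J "F x" "\<Sum>x\<in>A. F x"] by simp
qed auto

lemma wnorm_scalar_mult: "wnorm s I J (scalar c * F) = norm c * wnorm s I J F"
  unfolding wnorm_def by (simp add: norm_mult sum_distrib_left mult.assoc)

lemma wnorm_one: "wnorm s I J 1 \<le> 1"
proof -
  have "norm (coeff2 1 i j) * s ^ (i + j) = (if i = 0 then if j = 0 then 1 else 0 else 0)" for i j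
    by (simp add: coeff2_def)
  then have "wnorm s I J 1 = (\<Sum>i<I. if i = 0 then (\<Sum>j<J. if j = 0 then 1 else 0) else 0)"
    unfolding wnorm_def by (intro sum.cong refl) simp
  also have "\<dots> \<le> 1" by simp
  finally show ?thesis .
qed

lemma wnorm_mono: "0 \<le> s \<Longrightarrow> I \<le> I' \<Longrightarrow> J \<le> J' \<Longrightarrow> wnorm s I J F \<le> wnorm s I' J' F"
  unfolding wnorm_def
  by (intro order_trans[OF sum_mono[OF sum_mono2] sum_mono2]) (auto intro!: sum_nonneg)

lemma sum_diagonals_le:
  fixes h :: "nat \<Rightarrow> nat \<Rightarrow> real"
  assumes "\<And>r q. 0 \<le> h r q"
  shows "(\<Sum>i<n. \<Sum>r\<le>i. h r (i - r)) \<le> (\<Sum>r<n. \<Sum>q<n. h r q)"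
proof -
  have "(\<Sum>i<n. \<Sum>r\<le>i. h r (i - r)) = (\<Sum>(r, q)\<in>{(r, q). r + q < n}. h r q)"
    by (rule sum.triangle_reindex[symmetric])
  also have "\<dots> \<le> (\<Sum>(r, q)\<in>{..<n} \<times> {..<n}. h r q)"
    by (rule sum_mono2) (auto simp: assms)
  finally show ?thesis by (simp add: sum.cartesian_product)
qed

lemma wnorm_mult:
  assumes "0 \<le> s"
  shows "wnorm s I J (F * G) \<le> wnorm s I J F * wnorm s I J G"
proof -
  define u where "u r l = norm (coeff2 F r l) * s ^ (r + l)" for r l
  define v where "v r l = norm (coeff2 G r l) * s ^ (r + l)" for r l
  have nn: "0 \<le> u r l" "0 \<le> v r l" for r l using assms by (auto simp: u_def v_def)
  have "norm (coeff2 (F * G) i j) * s ^ (i + j) \<le> (\<Sum>r\<le>i. \<Sum>l\<le>j. u r l * v (i - r) (j - l))" for i j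
  proof -
    have "norm (coeff2 (F * G) i j) \<le>
        (\<Sum>r\<le>i. \<Sum>l\<le>j. norm (coeff2 F r l) * norm (coeff2 G (i - r) (j - l)))"
      unfolding coeff2_mult by (intro order_trans[OF norm_sum] sum_mono) (auto simp: norm_mult)
    then have "norm (coeff2 (F * G) i j) * s ^ (i + j) \<le>
        (\<Sum>r\<le>i. \<Sum>l\<le>j. norm (coeff2 F r l) * norm (coeff2 G (i - r) (j - l))) * s ^ (i + j)"
      by (rule mult_right_mono) (use assms in simp)
    also have "\<dots> = (\<Sum>r\<le>i. \<Sum>l\<le>j. u r l * v (i - r) (j - l))"
      unfolding sum_distrib_right
    proof (intro sum.cong refl)
      fix r l assume "r \<in> {..i}" "l \<in> {..j}"
      then have "i + j = (r + l) + ((i - r) + (j - l))" by auto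
      then have "s ^ (i + j) = s ^ (r + l) * s ^ ((i - r) + (j - l))" by (metis power_add)
      then show "norm (coeff2 F r l) * norm (coeff2 G (i - r) (j - l)) * s ^ (i + j) =
          u r l * v (i - r) (j - l)" by (simp add: u_def v_def)
    qed
    finally show ?thesis .
  qed
  then have "wnorm s I J (F * G) \<le> (\<Sum>i<I. \<Sum>j<J. \<Sum>r\<le>i. \<Sum>l\<le>j. u r l * v (i - r) (j - l))"
    unfolding wnorm_def by (intro sum_mono)
  also have "\<dots> = (\<Sum>i<I. \<Sum>r\<le>i. \<Sum>j<J. \<Sum>l\<le>j. u r l * v (i - r) (j - l))"
    by (intro sum.cong refl sum.swap)
  also have "\<dots> \<le> (\<Sum>i<I. \<Sum>r\<le>i. \<Sum>l<J. \<Sum>m<J. u r l * v (i - r) m)"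
    using nn by (intro sum_mono sum_diagonals_le) auto
  also have "\<dots> \<le> (\<Sum>r<I. \<Sum>q<I. \<Sum>l<J. \<Sum>m<J. u r l * v q m)"
    using nn by (intro sum_diagonals_le) (auto intro!: sum_nonneg)
  also have "\<dots> = (\<Sum>r<I. \<Sum>l<J. \<Sum>q<I. \<Sum>m<J. u r l * v q m)"
    by (intro sum.cong refl sum.swap)
  also have "\<dots> = (\<Sum>r<I. \<Sum>l<J. u r l * (\<Sum>q<I. \<Sum>m<J. v q m))"
    by (simp only: sum_distrib_left)
  also have "\<dots> = wnorm s I J F * wnorm s I J G"
    by (simp only: sum_distrib_right wnorm_def u_def v_def)
  finally show ?thesis .
qed

text \<open>The shift of the truncation by \<open>m\<close> is what lets an estimate at one truncation be deduced from an
  estimate at a smaller one.\<close>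

lemma wnorm_X1_power_mult: "wnorm s (m + I) J (X1 ^ m * F) = s ^ m * wnorm s I J F"
proof -
  have "wnorm s (m + I) J (X1 ^ m * F) =
      (\<Sum>i = m..<m + I. \<Sum>j<J. norm (coeff2 (X1 ^ m * F) i j) * s ^ (i + j))"
    unfolding wnorm_def
    by (intro sum.mono_neutral_right) (auto simp: coeff2_X1_power_mult)
  also have "\<dots> = (\<Sum>i<I. \<Sum>j<J. norm (coeff2 F i j) * s ^ (m + i + j))"
    by (rule sum.reindex_bij_witness[of _ "\<lambda>i. i + m" "\<lambda>i. i - m"])
       (auto simp: coeff2_X1_power_mult)
  also have "\<dots> = s ^ m * wnorm s I J F"
    unfolding wnorm_def sum_distrib_left by (intro sum.cong refl) (simp add: power_add mult_ac)
  finally show ?thesis .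
qed

lemma wnorm_X1_power_mult_le: "0 \<le> s \<Longrightarrow> wnorm s I J (X1 ^ m * F) \<le> s ^ m * wnorm s I J F"
  using wnorm_mono[of s I "m + I" J J "X1 ^ m * F"] by (simp add: wnorm_X1_power_mult)

text \<open>Shrinking the radius by a factor \<open>c\<close> gains \<open>c ^ m\<close> on series whose terms all have total
  degree at least \<open>m\<close>.\<close>

lemma wnorm_shrink:
  assumes "0 \<le> s" "s \<le> s'" "0 < s'" and "\<And>i j. i + j < m \<Longrightarrow> coeff2 F i j = 0"
  shows "wnorm s I J F \<le> (s / s') ^ m * wnorm s' I J F"
  unfolding wnorm_def sum_distrib_left
proof (intro sum_mono)
  fix i j
  have "s ^ n \<le> (s / s') ^ m * s' ^ n" if "m \<le> n" for n
  proof -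
    have "s ^ n = (s / s') ^ n * s' ^ n" using assms by (simp add: power_divide)
    also have "\<dots> \<le> (s / s') ^ m * s' ^ n"
      using assms that by (intro mult_right_mono power_decreasing) auto
    finally show ?thesis .
  qed
  then have "norm (coeff2 F i j) * s ^ (i + j) \<le>
      norm (coeff2 F i j) * ((s / s') ^ m * s' ^ (i + j))" if "m \<le> i + j"
    using that by (intro mult_left_mono) auto
  then show "norm (coeff2 F i j) * s ^ (i + j) \<le> (s / s') ^ m * (norm (coeff2 F i j) * s' ^ (i + j))"
    using assms(4)[of i j] by (cases "i + j < m") (auto simp: mult.left_commute)
qed

lemma wnorm_mono_radius: "0 \<le> s \<Longrightarrow> s \<le> s' \<Longrightarrow> wnorm s I J F \<le> wnorm s' I J F"
  unfolding wnorm_def by (intro sum_mono mult_left_mono power_mono) auto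

lemma wnorm_shift: "0 \<le> s \<Longrightarrow> s ^ m * wnorm s I J (fps_shift m F) \<le> wnorm s (m + I) J F"
proof -
  assume s: "0 \<le> s"
  have "s ^ m * wnorm s I J (fps_shift m F) = wnorm s (m + I) J (X1 ^ m * fps_shift m F)"
    by (rule wnorm_X1_power_mult[symmetric])
  also have "\<dots> \<le> wnorm s (m + I) J F"
    unfolding wnorm_def using s
    by (intro sum_mono mult_right_mono) (auto simp: coeff2_X1_power_mult coeff2_shift)
  finally show ?thesis .
qed

text \<open>At small radii this makes the norm of the Jacobi matrix comparable to that of its constant term,
  whatever the size of its higher coefficients.\<close>

lemma wnorm_le_constant_term_plus:
  assumes "0 \<le> s" "s \<le> s'" "0 < s'"
  shows "wnorm s I J F \<le> norm (coeff2 F 0 0) + s / s' * wnorm s' I J F"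
proof -
  define F' where "F' = F - scalar (coeff2 F 0 0)"
  have F': "coeff2 F' i j = (if i = 0 \<and> j = 0 then 0 else coeff2 F i j)" for i j
    by (simp add: F'_def coeff2_scalar)
  have "F = scalar (coeff2 F 0 0) * 1 + F'" by (simp add: F'_def)
  then have "wnorm s I J F \<le> norm (coeff2 F 0 0) * wnorm s I J 1 + wnorm s I J F'"
    using wnorm_add[OF assms(1)] wnorm_scalar_mult by metis
  moreover have "norm (coeff2 F 0 0) * wnorm s I J 1 \<le> norm (coeff2 F 0 0)"
    using mult_left_mono[OF wnorm_one norm_ge_zero] by simp
  moreover have "wnorm s I J F' \<le> (s / s') ^ 1 * wnorm s' I J F'"
    using assms by (intro wnorm_shrink) (auto simp: F')
  moreover have "wnorm s' I J F' \<le> wnorm s' I J F"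
    unfolding wnorm_def using assms by (intro sum_mono mult_right_mono) (auto simp: F')
  then have "(s / s') ^ 1 * wnorm s' I J F' \<le> s / s' * wnorm s' I J F"
    using assms by (simp add: mult_left_mono divide_right_mono)
  ultimately show ?thesis by linarith
qed

text \<open>On polynomials in \<open>x\<^sub>1\<close> of degree below \<open>N\<close>, the operator \<open>x\<^sub>1 \<partial>/\<partial>x\<^sub>1\<close> multiplies coefficients by
  numbers less than \<open>N\<close>.\<close>

lemma wnorm_Euler_cutoff:
  assumes "0 \<le> s" "s \<le> 1" "1 \<le> p"
  shows "wnorm s I J (X1 ^ p * deriv_x1 (fps_cutoff N F)) \<le> real N * wnorm s I J (fps_cutoff N F)"
proof -
  have "X1 ^ p * deriv_x1 (fps_cutoff N F) = X1 ^ (p - 1) * (X1 ^ 1 * deriv_x1 (fps_cutoff N F))"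
    using assms(3) by (simp add: mult.assoc flip: power_Suc2)
  then have "wnorm s I J (X1 ^ p * deriv_x1 (fps_cutoff N F)) \<le>
      s ^ (p - 1) * wnorm s I J (X1 ^ 1 * deriv_x1 (fps_cutoff N F))"
    using wnorm_X1_power_mult_le[OF assms(1)] by metis
  also have "\<dots> \<le> 1 * wnorm s I J (X1 ^ 1 * deriv_x1 (fps_cutoff N F))"
    using assms by (intro mult_right_mono power_le_one wnorm_nonneg)
  also have "wnorm s I J (X1 ^ 1 * deriv_x1 (fps_cutoff N F)) \<le> real N * wnorm s I J (fps_cutoff N F)"
    unfolding wnorm_def sum_distrib_left
  proof (intro sum_mono)
    fix i j
    have "coeff2 (X1 ^ 1 * deriv_x1 (fps_cutoff N F)) i j = of_nat i * coeff2 (fps_cutoff N F) i j"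
      unfolding coeff2_X1_power_mult coeff2_deriv_x1 by (cases i) auto
    moreover have "real i * norm (coeff2 (fps_cutoff N F) i j) \<le> real N * norm (coeff2 (fps_cutoff N F) i j)"
      by (auto simp: coeff2_cutoff intro: mult_right_mono)
    ultimately have "norm (coeff2 (X1 ^ 1 * deriv_x1 (fps_cutoff N F)) i j) \<le>
        real N * norm (coeff2 (fps_cutoff N F) i j)"
      by (simp add: norm_mult)
    from mult_right_mono[OF this, of "s ^ (i + j)"] assms(1)
    show "norm (coeff2 (X1 ^ 1 * deriv_x1 (fps_cutoff N F)) i j) * s ^ (i + j) \<le>
        real N * (norm (coeff2 (fps_cutoff N F) i j) * s ^ (i + j))"
      by (simp add: mult.assoc)
  qed
  finally show ?thesis by simp
qed

section \<open>Power series in several series\<close>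

abbreviation deg :: "('m::finite \<Rightarrow> nat) \<Rightarrow> nat"
  where "deg \<alpha> \<equiv> (\<Sum>k\<in>UNIV. \<alpha> k)"

definition incr :: "'m \<Rightarrow> ('m \<Rightarrow> nat) \<Rightarrow> 'm \<Rightarrow> nat"
  where "incr k \<alpha> = \<alpha>(k := Suc (\<alpha> k))"

definition decr :: "'m \<Rightarrow> ('m \<Rightarrow> nat) \<Rightarrow> 'm \<Rightarrow> nat"
  where "decr k \<alpha> = \<alpha>(k := \<alpha> k - 1)"

lemma deg_incr [simp]: "deg (incr k \<alpha>) = Suc (deg (\<alpha> :: 'm::finite \<Rightarrow> nat))"
  by (simp add: incr_def sum.remove[of UNIV k])

lemma incr_same [simp]: "incr k \<alpha> k = Suc (\<alpha> k)"
  by (simp add: incr_def)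

lemma decr_incr [simp]: "decr k (incr k \<alpha>) = \<alpha>"
  by (simp add: incr_def decr_def)

lemma incr_decr: "0 < \<alpha> k \<Longrightarrow> incr k (decr k \<alpha>) = \<alpha>"
  by (simp add: incr_def decr_def)

lemma multi_index_induct [case_names zero incr]:
  fixes \<alpha> :: "'m::finite \<Rightarrow> nat"
  assumes "P (\<lambda>_. 0)" and "\<And>\<alpha> k. P \<alpha> \<Longrightarrow> P (incr k \<alpha>)"
  shows "P \<alpha>"
proof (induction "deg \<alpha>" arbitrary: \<alpha>)
  case 0
  then have "\<alpha> = (\<lambda>_. 0)" by auto
  then show ?case using assms(1) by simp
next
  case (Suc n)
  then obtain k where k: "0 < \<alpha> k" by (metis gr0I sum.neutral nat.distinct(1))
  then have "deg (decr k \<alpha>) = n" using Suc.hyps(2) deg_incr[of k "decr k \<alpha>"] by (simp add: incr_decr)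
  then show ?case using assms(2)[OF Suc.hyps(1), of "decr k \<alpha>" k] k by (simp add: incr_decr)
qed

definition monomial :: "('m::finite \<Rightarrow> series2) \<Rightarrow> ('m \<Rightarrow> nat) \<Rightarrow> series2"
  where "monomial \<Phi> \<alpha> = (\<Prod>k\<in>UNIV. \<Phi> k ^ \<alpha> k)"

lemma monomial_zero [simp]: "monomial \<Phi> (\<lambda>_. 0) = 1"
  by (simp add: monomial_def)

lemma monomial_incr: "monomial \<Phi> (incr k \<alpha>) = \<Phi> k * monomial \<Phi> \<alpha>"
  unfolding monomial_def incr_def by (simp add: prod.remove[of UNIV k] mult_ac)

lemma wnorm_monomial:
  assumes "0 \<le> s" "\<And>k. wnorm s I J (\<Phi> k) \<le> \<sigma>"
  shows "wnorm s I J (monomial \<Phi> \<alpha>) \<le> \<sigma> ^ deg \<alpha>"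
proof (induction \<alpha> rule: multi_index_induct)
  case (incr \<alpha> k)
  have "wnorm s I J (\<Phi> k * monomial \<Phi> \<alpha>) \<le> \<sigma> * \<sigma> ^ deg \<alpha>"
    using assms incr wnorm_nonneg[OF assms(1)] order_trans[OF wnorm_nonneg assms(2)]
    by (intro order_trans[OF wnorm_mult] mult_mono) auto
  then show ?case by (simp add: monomial_incr)
qed (simp add: wnorm_one)

text \<open>Up to any given total degree a formal substitution agrees with a polynomial expression in the
  series substituted.  Identities for substitutions are therefore derived from finite sums.\<close>

definition agree_upto :: "nat \<Rightarrow> series2 \<Rightarrow> series2 \<Rightarrow> bool"
  where "agree_upto L F G \<longleftrightarrow> (\<forall>i j. i + j \<le> L \<longrightarrow> coeff2 F i j = coeff2 G i j)"

lemma agree_upto_mult: "agree_upto L F F' \<Longrightarrow> agree_upto L G G' \<Longrightarrow> agree_upto L (F * G) (F' * G')"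
  unfolding agree_upto_def coeff2_mult by (intro allI impI sum.cong refl) auto

lemma agree_upto_sum:
  "(\<And>x. x \<in> A \<Longrightarrow> agree_upto L (F x) (G x)) \<Longrightarrow> agree_upto L (\<Sum>x\<in>A. F x) (\<Sum>x\<in>A. G x)"
  by (simp add: agree_upto_def coeff2_sum)

definition psum :: "nat \<Rightarrow> (('m::finite \<Rightarrow> nat) \<Rightarrow> complex) \<Rightarrow> ('m \<Rightarrow> series2) \<Rightarrow> series2"
  where "psum L a \<Phi> = (\<Sum>\<alpha> | deg \<alpha> \<le> L. scalar (a \<alpha>) * monomial \<Phi> \<alpha>)"

lemma formal_subst_agree_psum:
  assumes "\<And>k. coeff2 (\<Phi> k) 0 0 = 0"
  shows "agree_upto L (formal_subst a \<Phi>) (psum L a \<Phi>)"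
  unfolding agree_upto_def
proof (intro allI impI)
  fix i j assume ij: "i + j \<le> L"
  have "coeff2 (formal_subst a \<Phi>) i j =
      (\<Sum>\<alpha> | deg \<alpha> \<le> i + j. a \<alpha> * coeff2 (monomial \<Phi> \<alpha>) i j)"
    by (simp add: formal_subst_def coeff2_def monomial_def)
  also have "\<dots> = (\<Sum>\<alpha> | deg \<alpha> \<le> L. a \<alpha> * coeff2 (monomial \<Phi> \<alpha>) i j)"
    using ij coeff2_prod_power_eq_0[of \<Phi> i j, OF assms]
    by (intro sum.mono_neutral_left finite_bounded_multi_indices) (auto simp: monomial_def not_le)
  also have "\<dots> = coeff2 (psum L a \<Phi>) i j"
    by (simp add: psum_def coeff2_sum)
  finally show "coeff2 (formal_subst a \<Phi>) i j = coeff2 (psum L a \<Phi>) i j" .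
qed

text \<open>Truncating the series substituted at order \<open>N\<close> in \<open>x\<^sub>1\<close> changes the result only from order \<open>N\<close> on; the
  divisibility of the Jacobi matrix by a power of \<open>x\<^sub>1\<close> thus passes to a truncated solution.\<close>

lemma coeff2_formal_subst_cutoff:
  assumes "\<And>k. coeff2 (\<Phi> k) 0 0 = 0" "i < N"
  shows "coeff2 (formal_subst a (\<lambda>k. fps_cutoff N (\<Phi> k))) i j = coeff2 (formal_subst a \<Phi>) i j"
proof -
  have "coeff2 (monomial (\<lambda>k. fps_cutoff N (\<Phi> k)) \<alpha>) i j = coeff2 (monomial \<Phi> \<alpha>) i j"
    if "i < N" for \<alpha> i j
    using that
  proof (induction \<alpha> arbitrary: i j rule: multi_index_induct)
    case (incr \<alpha> k)
    then show ?case
      unfolding monomial_incr coeff2_mult by (intro sum.cong refl) (auto simp: coeff2_cutoff)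
  qed simp
  then show ?thesis
    using assms(2) by (simp add: formal_subst_def coeff2_def monomial_def)
qed

definition geometric_bound :: "real \<Rightarrow> real \<Rightarrow> (('m::finite \<Rightarrow> nat) \<Rightarrow> complex) \<Rightarrow> bool"
  where "geometric_bound A \<rho> a \<longleftrightarrow> (\<forall>\<alpha>. norm (a \<alpha>) \<le> A / \<rho> ^ deg \<alpha>)"

text \<open>Dominated by a product of geometric series of ratio at most \<open>1 / 2\<close>, one for each variable.\<close>

lemma sum_geometric_bound:
  fixes a :: "('m::finite \<Rightarrow> nat) \<Rightarrow> complex"
  assumes a: "geometric_bound A \<rho> a" and "0 < \<rho>" "0 \<le> \<sigma>" "2 * \<sigma> \<le> \<rho>"
  shows "(\<Sum>\<alpha> | deg \<alpha> \<le> L. norm (a \<alpha>) * \<sigma> ^ deg \<alpha>) \<le> A * 2 ^ CARD('m)"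
proof -
  define q where "q = \<sigma> / \<rho>"
  have q: "0 \<le> q" "q \<le> 1 / 2" using assms by (auto simp: q_def field_simps)
  have A: "0 \<le> A"
    using a norm_ge_zero[of "a (\<lambda>_. 0)"] unfolding geometric_bound_def
    by (metis div_by_1 order_trans power_0 sum.neutral_const)
  have "(\<Sum>\<alpha> | deg \<alpha> \<le> L. norm (a \<alpha>) * \<sigma> ^ deg \<alpha>) \<le>
      (\<Sum>\<alpha> | deg \<alpha> \<le> L. A * (\<Prod>k\<in>(UNIV :: 'm set). q ^ \<alpha> k))"
  proof (intro sum_mono)
    fix \<alpha> :: "'m \<Rightarrow> nat"
    have "norm (a \<alpha>) * \<sigma> ^ deg \<alpha> \<le> A / \<rho> ^ deg \<alpha> * \<sigma> ^ deg \<alpha>"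
      using a assms by (intro mult_right_mono) (auto simp: geometric_bound_def)
    then show "norm (a \<alpha>) * \<sigma> ^ deg \<alpha> \<le> A * (\<Prod>k\<in>UNIV. q ^ \<alpha> k)"
      by (simp add: q_def power_divide prod_dividef power_sum)
  qed
  also have "\<dots> \<le> (\<Sum>\<alpha>\<in>PiE UNIV (\<lambda>_. {..L}). A * (\<Prod>k\<in>(UNIV :: 'm set). q ^ \<alpha> k))"
  proof (rule sum_mono2)
    have "\<alpha> k \<le> deg \<alpha>" for \<alpha> :: "'m \<Rightarrow> nat" and k by (rule member_le_sum) auto
    then show "{\<alpha> :: 'm \<Rightarrow> nat. deg \<alpha> \<le> L} \<subseteq> PiE UNIV (\<lambda>_. {..L})"
      using order_trans by fastforce
  qed (use A q in \<open>auto intro!: finite_PiE mult_nonneg_nonneg prod_nonneg\<close>)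
  also have "\<dots> = A * (\<Sum>\<alpha>\<in>PiE UNIV (\<lambda>_. {..L}). \<Prod>k\<in>(UNIV :: 'm set). q ^ \<alpha> k)"
    by (simp only: sum_distrib_left)
  also have "\<dots> = A * (\<Prod>k\<in>(UNIV :: 'm set). \<Sum>n\<le>L. q ^ n)"
    by (subst prod_sum_PiE) auto
  also have "\<dots> \<le> A * (\<Prod>k\<in>(UNIV :: 'm set). 2)"
  proof (intro mult_left_mono prod_mono conjI sum_nonneg)
    have "(\<Sum>n\<le>L. q ^ n) \<le> (\<Sum>n. q ^ n)"
      using q by (intro sum_le_suminf summable_geometric) auto
    also have "\<dots> = 1 / (1 - q)" using q by (intro suminf_geometric) auto
    also have "\<dots> \<le> 2" using q by (simp add: field_simps)
    finally show "(\<Sum>n\<le>L. q ^ n) \<le> 2" .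
  qed (use A q in auto)
  finally show ?thesis by simp
qed

lemma wnorm_formal_subst:
  fixes a :: "('m::finite \<Rightarrow> nat) \<Rightarrow> complex"
  assumes "\<And>k. coeff2 (\<Phi> k) 0 0 = 0" "0 \<le> s" "\<And>k. wnorm s I J (\<Phi> k) \<le> \<sigma>"
    and "geometric_bound A \<rho> a" "0 < \<rho>" "2 * \<sigma> \<le> \<rho>"
  shows "wnorm s I J (formal_subst a \<Phi>) \<le> A * 2 ^ CARD('m)"
proof -
  have \<sigma>: "0 \<le> \<sigma>" using order_trans[OF wnorm_nonneg[OF assms(2)] assms(3)] .
  have "wnorm s I J (formal_subst a \<Phi>) = wnorm s I J (psum (I + J) a \<Phi>)"
    using formal_subst_agree_psum[of \<Phi> "I + J" a, OF assms(1)]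
    unfolding wnorm_def by (intro sum.cong refl) (auto simp: agree_upto_def)
  also have "\<dots> \<le> (\<Sum>\<alpha> | deg \<alpha> \<le> I + J. norm (a \<alpha>) * \<sigma> ^ deg \<alpha>)"
    unfolding psum_def
    by (intro order_trans[OF wnorm_sum] sum_mono)
       (auto simp: wnorm_scalar_mult assms intro!: mult_left_mono wnorm_monomial)
  also have "\<dots> \<le> A * 2 ^ CARD('m)"
    by (rule sum_geometric_bound) (use assms \<sigma> in auto)
  finally show ?thesis .
qed

text \<open>The coefficients of \<open>\<partial>F/\<partial>z\<^sub>k\<close> in terms of those of \<open>F\<close>.\<close>

definition partial_coeff :: "'m \<Rightarrow> (('m::finite \<Rightarrow> nat) \<Rightarrow> complex) \<Rightarrow> ('m \<Rightarrow> nat) \<Rightarrow> complex"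
  where "partial_coeff k a \<alpha> = of_nat (Suc (\<alpha> k)) * a (incr k \<alpha>)"

text \<open>The factor \<open>\<alpha> k + 1 \<le> 2 ^ deg \<alpha>\<close> is absorbed by halving the radius.\<close>

lemma geometric_bound_partial_coeff:
  assumes "geometric_bound A \<rho> a" "0 < \<rho>"
  shows "geometric_bound (A / \<rho>) (\<rho> / 2) (partial_coeff k a)"
  unfolding geometric_bound_def
proof
  fix \<alpha> :: "'a \<Rightarrow> nat"
  have "Suc (\<alpha> k) \<le> 2 ^ \<alpha> k" by (simp add: Suc_leI)
  also have "\<dots> \<le> 2 ^ deg \<alpha>" by (intro power_increasing member_le_sum) auto
  finally have "real (Suc (\<alpha> k)) \<le> 2 ^ deg \<alpha>" by (metis of_nat_le_iff of_nat_numeral of_nat_power)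
  moreover have "norm (a (incr k \<alpha>)) \<le> A / \<rho> ^ Suc (deg \<alpha>)"
    using assms(1) deg_incr[of k \<alpha>] unfolding geometric_bound_def by metis
  ultimately have "real (Suc (\<alpha> k)) * norm (a (incr k \<alpha>)) \<le> 2 ^ deg \<alpha> * (A / \<rho> ^ Suc (deg \<alpha>))"
    by (intro mult_mono) auto
  then show "norm (partial_coeff k a \<alpha>) \<le> A / \<rho> / (\<rho> / 2) ^ deg \<alpha>"
    by (simp add: partial_coeff_def norm_mult power_divide mult_ac del: of_nat_Suc)
qed

section \<open>Taylor expansion to second order\<close>

text \<open>The derivative of a monomial at \<open>P\<close> in direction \<open>\<psi>\<close>.\<close>

definition monomial_deriv ::
    "('m::finite \<Rightarrow> series2) \<Rightarrow> ('m \<Rightarrow> series2) \<Rightarrow> ('m \<Rightarrow> nat) \<Rightarrow> series2"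
  where "monomial_deriv P \<psi> \<alpha> = (\<Sum>k\<in>UNIV. of_nat (\<alpha> k) * (\<psi> k * monomial P (decr k \<alpha>)))"

lemma monomial_deriv_incr:
  "monomial_deriv P \<psi> (incr k \<alpha>) = P k * monomial_deriv P \<psi> \<alpha> + \<psi> k * monomial P \<alpha>"
proof -
  have "of_nat (incr k \<alpha> h) * (\<psi> h * monomial P (decr h (incr k \<alpha>))) =
      P k * (of_nat (\<alpha> h) * (\<psi> h * monomial P (decr h \<alpha>))) +
      (if h = k then \<psi> k * monomial P \<alpha> else 0)" for h
  proof (cases "h = k")
    case True
    have "of_nat (\<alpha> k) * monomial P \<alpha> = of_nat (\<alpha> k) * (P k * monomial P (decr k \<alpha>))"
      using monomial_incr[of P k "decr k \<alpha>"] by (cases "0 < \<alpha> k") (auto simp: incr_decr)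
    then have "of_nat (Suc (\<alpha> k)) * (\<psi> k * monomial P \<alpha>) =
        \<psi> k * (of_nat (\<alpha> k) * (P k * monomial P (decr k \<alpha>))) + \<psi> k * monomial P \<alpha>"
      by (simp only: of_nat_Suc distrib_right distrib_left mult.left_commute[of _ "\<psi> k"] mult_1_left add.commute)
    then show ?thesis using True by (simp add: mult_ac)
  next
    case False
    then have "decr h (incr k \<alpha>) = incr k (decr h \<alpha>)" "incr k \<alpha> h = \<alpha> h"
      by (auto simp: incr_def decr_def)
    then show ?thesis using False by (simp add: monomial_incr mult_ac)
  qed
  then show ?thesis
    by (simp add: monomial_deriv_def sum.distrib sum_distrib_left)
qed

lemma wnorm_monomial_deriv:
  assumes "0 \<le> s" "0 < \<sigma>" "\<And>k. wnorm s I J (P k) \<le> \<sigma>" "\<And>k. wnorm s I J (\<psi> k) \<le> w"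
  shows "wnorm s I J (monomial_deriv P \<psi> \<alpha>) \<le> (2 * \<sigma>) ^ deg \<alpha> * (w / \<sigma>)"
proof (induction \<alpha> rule: multi_index_induct)
  case zero
  have "0 \<le> w" using order_trans[OF wnorm_nonneg[OF assms(1)] assms(4)] .
  then show ?case using assms(2) by (simp add: monomial_deriv_def)
next
  case (incr \<alpha> k)
  let ?d = "deg \<alpha>" and ?n = "wnorm s I J"
  have w: "0 \<le> w" using order_trans[OF wnorm_nonneg[OF assms(1)] assms(4)] .
  have "?n (monomial_deriv P \<psi> (incr k \<alpha>)) \<le>
      ?n (P k) * ?n (monomial_deriv P \<psi> \<alpha>) + ?n (\<psi> k) * ?n (monomial P \<alpha>)"
    unfolding monomial_deriv_incr
    by (intro order_trans[OF wnorm_add] add_mono wnorm_mult assms(1))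
  also have "\<dots> \<le> \<sigma> * ((2 * \<sigma>) ^ ?d * (w / \<sigma>)) + w * \<sigma> ^ ?d"
    using assms w incr.IH
    by (intro add_mono mult_mono wnorm_monomial) (auto intro: wnorm_nonneg)
  also have "\<dots> = (2 ^ ?d + 1) * (w * \<sigma> ^ ?d)"
    using assms(2) by (simp add: field_simps power_mult_distrib)
  also have "\<dots> \<le> (2 * 2 ^ ?d) * (w * \<sigma> ^ ?d)"
    using w assms(2) one_le_power[of "2::real" ?d] by (intro mult_right_mono) auto
  also have "\<dots> = (2 * \<sigma>) ^ deg (incr k \<alpha>) * (w / \<sigma>)"
    using assms(2) by (simp add: field_simps power_mult_distrib)
  finally show ?case .
qed

text \<open>By induction on the degree, multiplying the expansion by one more factor \<open>P k + X1 ^ N * \<psi> k\<close>.  The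
  remainder \<open>G\<close> becomes \<open>P k * G + \<psi> k * D + X1 ^ N * \<psi> k * G\<close> with \<open>D\<close> the linear term; the constant \<open>4\<close>
  is chosen such that \<open>2 * 4 ^ d + 2 ^ d \<le> 4 ^ (d + 1)\<close>.\<close>

lemma monomial_taylor:
  fixes P \<psi> :: "'m::finite \<Rightarrow> series2"
  shows "\<exists>G. monomial (\<lambda>k. P k + X1 ^ N * \<psi> k) \<alpha> =
      monomial P \<alpha> + X1 ^ N * monomial_deriv P \<psi> \<alpha> + X1 ^ (2 * N) * G \<and>
    (\<forall>s \<sigma> w I J. 0 \<le> s \<longrightarrow> 0 < \<sigma> \<longrightarrow> (\<forall>k. wnorm s I J (P k) \<le> \<sigma>) \<longrightarrow>
      (\<forall>k. wnorm s I J (\<psi> k) \<le> w) \<longrightarrow> s ^ N * w \<le> \<sigma> \<longrightarrow>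
      wnorm s I J G \<le> (4 * \<sigma>) ^ deg \<alpha> * (w / \<sigma>)\<^sup>2)"
proof (induction \<alpha> rule: multi_index_induct)
  case zero
  show ?case by (intro exI[of _ 0]) (auto simp: monomial_deriv_def)
next
  case (incr \<alpha> k)
  let ?\<Phi> = "\<lambda>k. P k + X1 ^ N * \<psi> k" and ?D = "monomial_deriv P \<psi>"
  obtain G where G: "monomial ?\<Phi> \<alpha> = monomial P \<alpha> + X1 ^ N * ?D \<alpha> + X1 ^ (2 * N) * G"
    and bound: "\<And>s \<sigma> w I J. 0 \<le> s \<Longrightarrow> 0 < \<sigma> \<Longrightarrow> (\<And>k. wnorm s I J (P k) \<le> \<sigma>) \<Longrightarrow>
      (\<And>k. wnorm s I J (\<psi> k) \<le> w) \<Longrightarrow> s ^ N * w \<le> \<sigma> \<Longrightarrow>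
      wnorm s I J G \<le> (4 * \<sigma>) ^ deg \<alpha> * (w / \<sigma>)\<^sup>2"
    using incr.IH by blast
  let ?G = "P k * G + \<psi> k * ?D \<alpha> + X1 ^ N * (\<psi> k * G)"
  have eq: "monomial ?\<Phi> (incr k \<alpha>) =
      monomial P (incr k \<alpha>) + X1 ^ N * ?D (incr k \<alpha>) + X1 ^ (2 * N) * ?G"
    unfolding monomial_incr monomial_deriv_incr G mult_2 power_add
    by (simp add: algebra_simps)
  have "wnorm s I J ?G \<le> (4 * \<sigma>) ^ deg (incr k \<alpha>) * (w / \<sigma>)\<^sup>2"
    if s: "0 \<le> s" and \<sigma>: "0 < \<sigma>" and P: "\<And>k. wnorm s I J (P k) \<le> \<sigma>"
      and \<psi>: "\<And>k. wnorm s I J (\<psi> k) \<le> w" and w\<sigma>: "s ^ N * w \<le> \<sigma>" for s \<sigma> w I J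
  proof -
    let ?n = "wnorm s I J" and ?d = "deg \<alpha>"
    let ?b = "(4 * \<sigma>) ^ ?d * (w / \<sigma>)\<^sup>2"
    have w: "0 \<le> w" using order_trans[OF wnorm_nonneg[OF s] \<psi>] .
    have b: "?n G \<le> ?b" "0 \<le> ?b" using bound[OF s \<sigma> P \<psi> w\<sigma>] \<sigma> by auto
    have "?n ?G \<le> ?n (P k * G) + ?n (\<psi> k * ?D \<alpha>) + ?n (X1 ^ N * (\<psi> k * G))"
      by (meson s add_mono order_refl order_trans wnorm_add)
    also have "\<dots> \<le> \<sigma> * ?b + w * ((2 * \<sigma>) ^ ?d * (w / \<sigma>)) + s ^ N * (w * ?b)"
      using s \<sigma> P \<psi> w b
      by (intro add_mono order_trans[OF wnorm_mult] order_trans[OF wnorm_X1_power_mult_le]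
            mult_mono wnorm_monomial_deriv mult_left_mono)
         (auto intro: wnorm_nonneg)
    also have "\<dots> \<le> \<sigma> * ?b + w * ((2 * \<sigma>) ^ ?d * (w / \<sigma>)) + \<sigma> * ?b"
      using mult_right_mono[OF w\<sigma> b(2)] by (simp add: mult_ac)
    also have "\<dots> = \<sigma> * \<sigma> ^ ?d * (w / \<sigma>)\<^sup>2 * (2 * 4 ^ ?d + 2 ^ ?d)"
      using \<sigma> by (simp add: field_simps power_mult_distrib power2_eq_square)
    also have "\<dots> \<le> \<sigma> * \<sigma> ^ ?d * (w / \<sigma>)\<^sup>2 * (4 * 4 ^ ?d)"
      using \<sigma> power_mono[of 2 "4::real" ?d] zero_le_power[of "4::real" ?d]
      by (intro mult_left_mono) (linarith, simp)
    also have "\<dots> = (4 * \<sigma>) ^ deg (incr k \<alpha>) * (w / \<sigma>)\<^sup>2"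
      by (simp add: power_mult_distrib mult_ac)
    finally show ?thesis .
  qed
  then show ?case using eq by blast
qed

text \<open>The linear terms of all monomials of degree at most \<open>L + 1\<close>, collected by the direction of
  differentiation and reindexed.\<close>

lemma psum_partial_coeff:
  "(\<Sum>\<alpha> | deg \<alpha> \<le> Suc L. scalar (a \<alpha>) * monomial_deriv P \<psi> \<alpha>) =
    (\<Sum>k\<in>UNIV. \<psi> k * psum L (partial_coeff k a) P)"
proof -
  have "(\<Sum>\<alpha> | deg \<alpha> \<le> Suc L. scalar (a \<alpha>) * (of_nat (\<alpha> k) * (\<psi> k * monomial P (decr k \<alpha>)))) =
      \<psi> k * psum L (partial_coeff k a) P" for k
  proof -
    have "(\<Sum>\<alpha> | deg \<alpha> \<le> Suc L. scalar (a \<alpha>) * (of_nat (\<alpha> k) * (\<psi> k * monomial P (decr k \<alpha>)))) =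
        (\<Sum>\<alpha> | deg \<alpha> \<le> Suc L \<and> 0 < \<alpha> k.
          scalar (a \<alpha>) * (of_nat (\<alpha> k) * (\<psi> k * monomial P (decr k \<alpha>))))"
      by (intro sum.mono_neutral_right finite_bounded_multi_indices) auto
    also have "\<dots> = (\<Sum>\<alpha> | deg \<alpha> \<le> L.
        scalar (a (incr k \<alpha>)) * (of_nat (Suc (\<alpha> k)) * (\<psi> k * monomial P \<alpha>)))"
    proof (rule sum.reindex_bij_witness[of _ "incr k" "decr k"])
      fix \<alpha> :: "'a \<Rightarrow> nat" assume "\<alpha> \<in> {\<alpha>. deg \<alpha> \<le> Suc L \<and> 0 < \<alpha> k}"
      then show "incr k (decr k \<alpha>) = \<alpha>" "decr k \<alpha> \<in> {\<alpha>. deg \<alpha> \<le> L}"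
        "scalar (a (incr k (decr k \<alpha>))) * (of_nat (Suc (decr k \<alpha> k)) * (\<psi> k * monomial P (decr k \<alpha>))) =
         scalar (a \<alpha>) * (of_nat (\<alpha> k) * (\<psi> k * monomial P (decr k \<alpha>)))"
        using deg_incr[of k "decr k \<alpha>"] by (auto simp: incr_decr) (auto simp: decr_def)
    qed auto
    also have "\<dots> = \<psi> k * psum L (partial_coeff k a) P"
      unfolding psum_def sum_distrib_left
      by (intro sum.cong refl)
         (simp only: partial_coeff_def scalar_mult scalar_of_nat mult_ac)
    finally show ?thesis .
  qed
  then show ?thesis
    unfolding monomial_deriv_def sum_distrib_left by (subst sum.swap) simp
qed

text \<open>The bound on the quadratic remainder \<open>G\<close> involves only the part of \<open>\<psi>\<close> inside the same box.  In the
  expansion \<open>G\<close> stands behind \<open>X1 ^ (2 * N)\<close>, so inside a given box the remainder is controlled by \<open>\<psi>\<close>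
  in a smaller one.\<close>

lemma formal_subst_taylor:
  fixes a :: "('m::finite \<Rightarrow> nat) \<Rightarrow> complex"
  assumes P0: "\<And>k. coeff2 (P k) 0 0 = 0" and N: "0 < N"
    and a: "geometric_bound A \<rho> a" "0 < \<rho>"
  obtains G where "formal_subst a (\<lambda>k. P k + X1 ^ N * \<psi> k) = formal_subst a P +
      X1 ^ N * (\<Sum>k\<in>UNIV. \<psi> k * formal_subst (partial_coeff k a) P) + X1 ^ (2 * N) * G"
    and "\<And>s \<sigma> w I J. 0 \<le> s \<Longrightarrow> 0 < \<sigma> \<Longrightarrow> 8 * \<sigma> \<le> \<rho> \<Longrightarrow> (\<And>k. wnorm s I J (P k) \<le> \<sigma>) \<Longrightarrow>
      (\<And>k. wnorm s I J (\<psi> k) \<le> w) \<Longrightarrow> s ^ N * w \<le> \<sigma> \<Longrightarrow>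
      wnorm s I J G \<le> A * 2 ^ CARD('m) * (w / \<sigma>)\<^sup>2"
proof -
  let ?\<Phi> = "\<lambda>k. P k + X1 ^ N * \<psi> k"
  let ?L = "X1 ^ N * (\<Sum>k\<in>UNIV. \<psi> k * formal_subst (partial_coeff k a) P)"
  obtain g where "\<forall>\<alpha>. monomial ?\<Phi> \<alpha> =
      monomial P \<alpha> + X1 ^ N * monomial_deriv P \<psi> \<alpha> + X1 ^ (2 * N) * g \<alpha> \<and>
    (\<forall>s \<sigma> w I J. 0 \<le> s \<longrightarrow> 0 < \<sigma> \<longrightarrow> (\<forall>k. wnorm s I J (P k) \<le> \<sigma>) \<longrightarrow>
      (\<forall>k. wnorm s I J (\<psi> k) \<le> w) \<longrightarrow> s ^ N * w \<le> \<sigma> \<longrightarrow>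
      wnorm s I J (g \<alpha>) \<le> (4 * \<sigma>) ^ deg \<alpha> * (w / \<sigma>)\<^sup>2)"
    using choice[OF allI[OF monomial_taylor[of P N \<psi>]]] by (rule exE)
  then have g: "\<And>\<alpha>. monomial ?\<Phi> \<alpha> =
      monomial P \<alpha> + X1 ^ N * monomial_deriv P \<psi> \<alpha> + X1 ^ (2 * N) * g \<alpha>"
    and gb: "\<And>\<alpha> s \<sigma> w I J. 0 \<le> s \<Longrightarrow> 0 < \<sigma> \<Longrightarrow> (\<And>k. wnorm s I J (P k) \<le> \<sigma>) \<Longrightarrow>
      (\<And>k. wnorm s I J (\<psi> k) \<le> w) \<Longrightarrow> s ^ N * w \<le> \<sigma> \<Longrightarrow>
      wnorm s I J (g \<alpha>) \<le> (4 * \<sigma>) ^ deg \<alpha> * (w / \<sigma>)\<^sup>2"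
    by blast+
  define S where "S L = (\<Sum>\<alpha> | deg \<alpha> \<le> Suc L. scalar (a \<alpha>) * g \<alpha>)" for L
  define R where "R = formal_subst a ?\<Phi> - formal_subst a P - ?L"
  have \<Phi>0: "coeff2 (?\<Phi> k) 0 0 = 0" for k
    using P0 N by (simp add: coeff2_X1_power_mult)
  have R: "coeff2 R i j = coeff2 (X1 ^ (2 * N) * S L) i j" if ij: "i + j \<le> L" for i j L
  proof -
    have "psum (Suc L) a ?\<Phi> = psum (Suc L) a P +
        X1 ^ N * (\<Sum>\<alpha> | deg \<alpha> \<le> Suc L. scalar (a \<alpha>) * monomial_deriv P \<psi> \<alpha>) + X1 ^ (2 * N) * S L"
      unfolding psum_def S_def g
      by (simp add: sum.distrib sum_distrib_left algebra_simps)
    moreover have "agree_upto L ?L (X1 ^ N *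
        (\<Sum>\<alpha> | deg \<alpha> \<le> Suc L. scalar (a \<alpha>) * monomial_deriv P \<psi> \<alpha>))"
      unfolding psum_partial_coeff
      by (intro agree_upto_mult agree_upto_sum formal_subst_agree_psum P0) (simp_all add: agree_upto_def)
    moreover have "agree_upto (Suc L) (formal_subst a ?\<Phi>) (psum (Suc L) a ?\<Phi>)"
      "agree_upto (Suc L) (formal_subst a P) (psum (Suc L) a P)"
      by (intro formal_subst_agree_psum P0 \<Phi>0)+
    ultimately show ?thesis
      using ij by (simp add: R_def agree_upto_def)
  qed
  define G where "G = fps_shift (2 * N) R"
  have G: "coeff2 G i j = coeff2 (S L) i j" if "i + j + 2 * N \<le> L" for i j L
    using R[of "i + 2 * N" j L] that by (simp add: G_def coeff2_shift coeff2_X1_power_mult)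
  have "coeff2 R i j = coeff2 (X1 ^ (2 * N) * G) i j" for i j
    using R[of i j "i + j + 2 * N"] G[of "i - 2 * N" j "i + j + 2 * N"]
    by (auto simp: coeff2_X1_power_mult)
  then have "R = X1 ^ (2 * N) * G" by (rule series2_eqI)
  then have "formal_subst a ?\<Phi> = formal_subst a P + ?L + X1 ^ (2 * N) * G"
    by (simp add: R_def algebra_simps)
  moreover have "wnorm s I J G \<le> A * 2 ^ CARD('m) * (w / \<sigma>)\<^sup>2"
    if s: "0 \<le> s" and \<sigma>: "0 < \<sigma>" "8 * \<sigma> \<le> \<rho>" and P: "\<And>k. wnorm s I J (P k) \<le> \<sigma>"
      and \<psi>: "\<And>k. wnorm s I J (\<psi> k) \<le> w" and w: "s ^ N * w \<le> \<sigma>" for s \<sigma> w I J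
  proof -
    let ?L = "I + J + 2 * N"
    have "wnorm s I J G = wnorm s I J (S ?L)"
      unfolding wnorm_def using G[of _ _ ?L] by (intro sum.cong refl) auto
    also have "\<dots> \<le> (\<Sum>\<alpha> | deg \<alpha> \<le> Suc ?L. norm (a \<alpha>) * ((4 * \<sigma>) ^ deg \<alpha> * (w / \<sigma>)\<^sup>2))"
      unfolding S_def
      by (intro order_trans[OF wnorm_sum[OF s]] sum_mono, unfold wnorm_scalar_mult)
         (intro mult_left_mono gb[OF s \<sigma>(1) P \<psi> w] norm_ge_zero)
    also have "\<dots> = (\<Sum>\<alpha> | deg \<alpha> \<le> Suc ?L. norm (a \<alpha>) * (4 * \<sigma>) ^ deg \<alpha>) * (w / \<sigma>)\<^sup>2"
      by (simp add: sum_distrib_right mult.assoc)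
    also have "\<dots> \<le> A * 2 ^ CARD('m) * (w / \<sigma>)\<^sup>2"
      using \<sigma> by (intro mult_right_mono sum_geometric_bound[OF a]) auto
    finally show ?thesis .
  qed
  ultimately show ?thesis by (rule that)
qed

section \<open>The a priori estimate\<close>

text \<open>One equation \<open>x\<^sub>1^p \<partial>\<Phi>\<^sub>j/\<partial>x\<^sub>1 = f\<^sub>j(\<Phi>)\<close>, \<open>j \<in> Y\<close>, suffices to pass from the finitely many coefficients of
  low order in \<open>x\<^sub>1\<close> (bounded uniformly over the truncations \<open>J \<in> \<J>\<close> in \<open>x\<^sub>2\<close>) to the whole series.  The
  indices outside \<open>Y\<close> are those of the independent variables.

  Write \<open>\<Phi> = P + x\<^sub>1^N \<psi>\<close> with \<open>P\<close> the truncation at order \<open>N\<close>.  The Jacobi matrix at \<open>P\<close> is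
  \<open>x\<^sub>1^(p-1) B\<close>.  Dividing the equation by \<open>x\<^sub>1^(N+p-1)\<close> yields
  \<open>(N + x\<^sub>1 \<partial>/\<partial>x\<^sub>1) \<psi> = g' + B \<psi> + x\<^sub>1^(N-p+1) G\<close>, where \<open>G\<close> is quadratic in \<open>\<psi>\<close>.  The left-hand side has norm
  at least \<open>N\<close> times that of \<open>\<psi>\<close>, whereas at a small radius the sum of the norms of the entries of \<open>B\<close>
  is close to the corresponding sum \<open>\<bar>B(0)\<bar>\<close> at the origin, which is the same for all \<open>N \<ge> p\<close>.  If
  \<open>N \<ge> \<bar>B(0)\<bar> + 2\<close>, the term \<open>B \<psi>\<close> can therefore be absorbed on the left.
  The factor \<open>x\<^sub>1^(N-p+1)\<close> makes the quadratic term small and dependent only on \<open>\<psi>\<close> in a smaller box, so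
  that the bound propagates by induction on the truncation in \<open>x\<^sub>1\<close>.\<close>

lemma formal_solution_bounded:
  fixes \<Phi> :: "'m::finite \<Rightarrow> series2" and a :: "'m \<Rightarrow> ('m \<Rightarrow> nat) \<Rightarrow> complex"
  assumes p: "1 \<le> p" and \<Phi>0: "\<And>k. coeff2 (\<Phi> k) 0 0 = 0"
    and linear: "\<And>k i j. k \<notin> Y \<Longrightarrow> 2 \<le> i \<Longrightarrow> coeff2 (\<Phi> k) i j = 0"
    and eq: "\<And>j. j \<in> Y \<Longrightarrow> X1 ^ p * deriv_x1 (\<Phi> j) = formal_subst (a j) \<Phi>"
    and a: "\<And>j. j \<in> Y \<Longrightarrow> geometric_bound A \<rho> (a j)" and \<rho>: "0 < \<rho>"
    and jac: "\<And>j k i l. j \<in> Y \<Longrightarrow> k \<in> Y \<Longrightarrow> i < p - 1 \<Longrightarrow>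
      coeff2 (formal_subst (partial_coeff k (a j)) \<Phi>) i l = 0"
    and init: "\<And>N. \<exists>s>0. \<exists>C. \<forall>k. \<forall>J\<in>\<J>. \<forall>I. wnorm s I J (fps_cutoff N (\<Phi> k)) \<le> C"
  shows "\<exists>s>0. \<exists>C. \<forall>k. \<forall>J\<in>\<J>. \<forall>I. wnorm s I J (\<Phi> k) \<le> C"
proof -
  (* The size of the matrix B at the origin, read off from the full solution and hence independent of N. *)
  define b0 where "b0 = (\<Sum>j\<in>Y. \<Sum>k\<in>Y.
    norm (coeff2 (formal_subst (partial_coeff k (a j)) \<Phi>) (p - 1) 0))"
  (* From 2 on, the truncation leaves the independent variables unchanged, so that their psi is 0. *)
  define N where "N = max p (max 2 (nat \<lceil>b0 + 2\<rceil>))"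
  have N: "p \<le> N" "2 \<le> N" and Nb: "b0 + 2 \<le> real N"
    by (auto simp: N_def) linarith
  define P where "P k = fps_cutoff N (\<Phi> k)" for k
  define \<psi> where "\<psi> k = fps_shift N (\<Phi> k)" for k
  have \<Phi>: "\<Phi> = (\<lambda>k. P k + X1 ^ N * \<psi> k)"
    by (simp add: P_def \<psi>_def cutoff_add_shift)
  have P0: "coeff2 (P k) 0 0 = 0" for k
    using \<Phi>0 by (simp add: P_def coeff2_cutoff)
  have \<psi>0: "\<psi> k = 0" if "k \<notin> Y" for k
    using linear[OF that] N by (intro series2_eqI) (auto simp: \<psi>_def coeff2_shift)
  define M where "M j k = formal_subst (partial_coeff k (a j)) P" for j k
  define B where "B j k = fps_shift (p - 1) (M j k)" for j k
  have M_coeff: "coeff2 (M j k) i l = coeff2 (formal_subst (partial_coeff k (a j)) \<Phi>) i l"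
    if "i < N" for j k i l
  proof -
    have "P = (\<lambda>k. fps_cutoff N (\<Phi> k))" by (simp add: P_def fun_eq_iff)
    then show ?thesis
      using coeff2_formal_subst_cutoff[of \<Phi> i N, OF \<Phi>0 that] by (simp add: M_def)
  qed
  have MB: "M j k = X1 ^ (p - 1) * B j k" if "j \<in> Y" "k \<in> Y" for j k
    using M_coeff jac[OF that] N
    by (intro series2_eqI) (auto simp: B_def coeff2_X1_power_mult coeff2_shift)
  define g where "g j = formal_subst (a j) P - X1 ^ p * deriv_x1 (P j)" for j
  define m where "m = N + (p - 1)"
  define g' where "g' j = fps_shift m (g j)" for j
  define small where "small G \<longleftrightarrow> (\<forall>s \<sigma> w I J. 0 \<le> s \<longrightarrow> 0 < \<sigma> \<longrightarrow> 8 * \<sigma> \<le> \<rho> \<longrightarrow>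
    (\<forall>k. wnorm s I J (P k) \<le> \<sigma>) \<longrightarrow> (\<forall>k. wnorm s I J (\<psi> k) \<le> w) \<longrightarrow> s ^ N * w \<le> \<sigma> \<longrightarrow>
    wnorm s I J G \<le> A * 2 ^ CARD('m) * (w / \<sigma>)\<^sup>2)" for G
  have "\<exists>G. formal_subst (a j) \<Phi> = formal_subst (a j) P +
      X1 ^ N * (\<Sum>k\<in>UNIV. \<psi> k * M j k) + X1 ^ (2 * N) * G \<and> small G" if j: "j \<in> Y" for j
  proof -
    have "0 < N" using N by simp
    then obtain G where "formal_subst (a j) (\<lambda>k. P k + X1 ^ N * \<psi> k) = formal_subst (a j) P +
        X1 ^ N * (\<Sum>k\<in>UNIV. \<psi> k * M j k) + X1 ^ (2 * N) * G" "small G"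
      unfolding small_def M_def
      by (rule formal_subst_taylor[of P N A \<rho> "a j" \<psi>, OF P0 _ a[OF j] \<rho>]) blast
    then show ?thesis unfolding \<Phi>[symmetric] by blast
  qed
  then obtain G where
    G: "\<And>j. j \<in> Y \<Longrightarrow> formal_subst (a j) \<Phi> = formal_subst (a j) P +
      X1 ^ N * (\<Sum>k\<in>UNIV. \<psi> k * M j k) + X1 ^ (2 * N) * G j"
    and small: "\<And>j. j \<in> Y \<Longrightarrow> small (G j)"
    by metis
  have Gb: "wnorm s I J (G j) \<le> A * 2 ^ CARD('m) * (w / \<sigma>)\<^sup>2"
    if "j \<in> Y" "0 \<le> s" "0 < \<sigma>" "8 * \<sigma> \<le> \<rho>" "\<And>k. wnorm s I J (P k) \<le> \<sigma>"
      "\<And>k. wnorm s I J (\<psi> k) \<le> w" "s ^ N * w \<le> \<sigma>" for j s \<sigma> w I J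
    using small[OF that(1)] that unfolding small_def by blast
  (* The equation divided by X1 ^ m, coefficient by coefficient. *)
  have key: "of_nat (N + i) * coeff2 (\<psi> j) i l =
      coeff2 (g' j + (\<Sum>k\<in>Y. B j k * \<psi> k) + X1 ^ Suc (N - p) * G j) i l" if j: "j \<in> Y" for j i l
  proof -
    have "(\<Sum>k\<in>UNIV. \<psi> k * M j k) = (\<Sum>k\<in>Y. \<psi> k * M j k)"
      by (rule sum.mono_neutral_right) (auto simp: \<psi>0)
    also have "\<dots> = X1 ^ (p - 1) * (\<Sum>k\<in>Y. B j k * \<psi> k)"
      unfolding sum_distrib_left by (intro sum.cong refl) (simp add: MB[OF j] mult_ac)
    finally have "X1 ^ N * (\<Sum>k\<in>UNIV. \<psi> k * M j k) = X1 ^ m * (\<Sum>k\<in>Y. B j k * \<psi> k)"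
      by (simp add: m_def power_add mult.assoc)
    then have "X1 ^ p * deriv_x1 (\<Phi> j) =
        formal_subst (a j) P + X1 ^ m * (\<Sum>k\<in>Y. B j k * \<psi> k) + X1 ^ (2 * N) * G j"
      using eq[OF j] G[OF j] by simp
    then have "coeff2 (X1 ^ p * deriv_x1 (\<Phi> j) - X1 ^ p * deriv_x1 (P j)) (i + m) l =
        coeff2 (g j + X1 ^ m * (\<Sum>k\<in>Y. B j k * \<psi> k) + X1 ^ (2 * N) * G j) (i + m) l"
      by (simp add: g_def)
    moreover have "coeff2 (X1 ^ p * deriv_x1 (\<Phi> j) - X1 ^ p * deriv_x1 (P j)) (i + m) l =
        of_nat (N + i) * coeff2 (\<psi> j) i l"
    proof -
      have "Suc (i + m - p) = i + N" "\<not> i + m < p" using p N by (auto simp: m_def)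
      then show ?thesis
        by (simp add: coeff2_X1_power_mult coeff2_deriv_x1 P_def coeff2_cutoff \<psi>_def coeff2_shift
            add.commute del: of_nat_Suc)
    qed
    moreover have "i + m < 2 * N \<longleftrightarrow> i < Suc (N - p)" "i + m - 2 * N = i - Suc (N - p)"
      using p N by (auto simp: m_def)
    ultimately show ?thesis
      by (cases "i < Suc (N - p)") (simp_all add: coeff2_X1_power_mult g'_def coeff2_shift del: power_Suc)
  qed

  (* The Taylor remainder is bounded through values at 4 * sigma, where the series must still
     converge at least like a geometric series of ratio 1 / 2. *)
  define \<sigma> where "\<sigma> = \<rho> / 8"
  have \<sigma>: "0 < \<sigma>" "8 * \<sigma> \<le> \<rho>" using \<rho> by (auto simp: \<sigma>_def)
  obtain s1 C where s1: "0 < s1" and C: "\<And>k I J. J \<in> \<J> \<Longrightarrow> wnorm s1 I J (P k) \<le> C"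
    using init[of N] unfolding P_def by blast
  (* P has no constant term, so a small radius brings its norm below sigma. *)
  define s0 where "s0 = min 1 (min s1 (s1 * \<sigma> / (\<bar>C\<bar> + 1)))"
  have s0: "0 < s0" "s0 \<le> 1" "s0 \<le> s1" using s1 \<sigma> by (auto simp: s0_def)
  have P\<sigma>: "wnorm s I J (P k) \<le> \<sigma>" if "0 \<le> s" "s \<le> s0" "J \<in> \<J>" for s I J k
  proof -
    have "wnorm s I J (P k) \<le> wnorm s0 I J (P k)"
      using that by (intro wnorm_mono_radius)
    also have "\<dots> \<le> (s0 / s1) ^ 1 * wnorm s1 I J (P k)"
      using s0 s1 P0 by (intro wnorm_shrink) auto
    also have "\<dots> \<le> (s0 / s1) * (\<bar>C\<bar> + 1)"
      using C[OF that(3), of I k] s0 s1 by (intro mult_mono) (auto intro: wnorm_nonneg)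
    also have "\<dots> \<le> (\<sigma> / (\<bar>C\<bar> + 1)) * (\<bar>C\<bar> + 1)"
    proof (intro mult_right_mono)
      have "s0 \<le> s1 * \<sigma> / (\<bar>C\<bar> + 1)" by (simp add: s0_def)
      then show "s0 / s1 \<le> \<sigma> / (\<bar>C\<bar> + 1)" using s1 by (simp add: field_simps)
    qed simp
    finally show ?thesis by simp
  qed

  define c where "c = (2::real) ^ CARD('m)"
  define b1 where "b1 = A / \<rho> * c / s0 ^ (p - 1)"
  have Bb1: "wnorm s0 I J (B j k) \<le> b1" if "J \<in> \<J>" "j \<in> Y" for I J j k
  proof -
    have "s0 ^ (p - 1) * wnorm s0 I J (B j k) \<le> wnorm s0 (p - 1 + I) J (M j k)"
      unfolding B_def using s0 by (intro wnorm_shift) simp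
    also have "\<dots> \<le> A / \<rho> * c"
      unfolding M_def c_def using s0 \<rho> \<sigma> that
      by (intro wnorm_formal_subst[OF P0 _ P\<sigma> geometric_bound_partial_coeff[OF a]]) auto
    finally have "wnorm s0 I J (B j k) * s0 ^ (p - 1) \<le> A / \<rho> * c" by (simp only: mult.commute)
    then show ?thesis unfolding b1_def using s0 by (simp only: pos_le_divide_eq zero_less_power)
  qed
  define g1 where "g1 = (A * c + real N * \<sigma>) / s0 ^ m"
  have gb: "wnorm s0 I J (g' j) \<le> g1" if "J \<in> \<J>" "j \<in> Y" for I J j
  proof -
    have "s0 ^ m * wnorm s0 I J (g' j) \<le> wnorm s0 (m + I) J (g j)"
      unfolding g'_def using s0 by (intro wnorm_shift) simp
    also have "\<dots> \<le> wnorm s0 (m + I) J (formal_subst (a j) P) + wnorm s0 (m + I) J (X1 ^ p * deriv_x1 (P j))"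
      unfolding g_def using s0 by (intro wnorm_diff) simp
    also have "\<dots> \<le> A * c + real N * wnorm s0 (m + I) J (P j)"
      unfolding c_def using s0 \<rho> \<sigma> that p
      by (intro add_mono wnorm_formal_subst[OF P0 _ P\<sigma> a])
         (auto simp: P_def intro!: wnorm_Euler_cutoff)
    also have "\<dots> \<le> A * c + real N * \<sigma>"
      using P\<sigma>[of s0 J] s0 that by (simp add: mult_left_mono)
    finally have "wnorm s0 I J (g' j) * s0 ^ m \<le> A * c + real N * \<sigma>" by (simp only: mult.commute)
    then show ?thesis unfolding g1_def using s0 by (simp only: pos_le_divide_eq zero_less_power)
  qed

  define n where "n = real (card Y)"
  (* w is the bound for psi that the induction preserves; s is then so small that the
     non-constant parts of the entries of B have total norm at most 1, and so do the quadratic terms. *)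
  define w where "w = \<bar>n * g1\<bar> + 1"
  define K where "K = A * c * (w / \<sigma>)\<^sup>2"
  define s where "s = min s0 (min (s0 / (\<bar>n * (n * b1)\<bar> + 1)) (min (1 / (\<bar>n * K\<bar> + 1)) (\<sigma> / w)))"
  have w: "0 < w" by (simp add: w_def add_nonneg_pos)
  have s: "0 < s" "s \<le> s0" using s0 \<sigma> w by (auto simp: s_def add_nonneg_pos)
  have s_le: "s \<le> 1" using s s0 by simp
  have sB: "s / s0 * (n * (n * b1)) \<le> 1"
  proof -
    have "s \<le> s0 / (\<bar>n * (n * b1)\<bar> + 1)" by (simp add: s_def)
    then have "s / s0 * (\<bar>n * (n * b1)\<bar> + 1) \<le> 1" using s0 by (simp add: field_simps)
    moreover have "s / s0 * (n * (n * b1)) \<le> s / s0 * (\<bar>n * (n * b1)\<bar> + 1)"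
      using s s0 by (intro mult_left_mono) auto
    ultimately show ?thesis by linarith
  qed
  have sK: "s * (n * K) \<le> 1"
  proof -
    have "s \<le> 1 / (\<bar>n * K\<bar> + 1)" by (simp add: s_def)
    then have "s * (\<bar>n * K\<bar> + 1) \<le> 1" by (simp add: field_simps)
    moreover have "s * (n * K) \<le> s * (\<bar>n * K\<bar> + 1)" using s by (intro mult_left_mono) auto
    ultimately show ?thesis by linarith
  qed
  have s\<sigma>: "s ^ N * w \<le> \<sigma>"
  proof -
    have "s ^ N \<le> s ^ 1" using s s_le N by (intro power_decreasing) auto
    then have "s ^ N * w \<le> s * w" using w by simp
    also have "s \<le> \<sigma> / w" by (simp add: s_def)
    then have "s * w \<le> \<sigma>" using w by (simp add: field_simps)
    finally show ?thesis .
  qed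

  define W where "W I J = (\<Sum>j\<in>Y. wnorm s I J (\<psi> j))" for I J
  have \<psi>W: "wnorm s I J (\<psi> k) \<le> W I J" for I J k
  proof (cases "k \<in> Y")
    case True
    then show ?thesis unfolding W_def using s by (intro member_le_sum) (auto intro: wnorm_nonneg)
  qed (use s in \<open>auto simp: \<psi>0 W_def intro!: sum_nonneg wnorm_nonneg\<close>)
  have W_bound: "W I J \<le> w" if J: "J \<in> \<J>" for I J
  proof (induction I)
    case 0
    show ?case using w by (simp add: W_def wnorm_def)
  next
    case (Suc I)
    let ?n = "wnorm s (Suc I) J"
    have s_nn: "0 \<le> s" using s by simp
    have step: "real N * ?n (\<psi> j) \<le> g1 + (\<Sum>k\<in>Y. ?n (B j k)) * W (Suc I) J + s * K" if j: "j \<in> Y" for j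
    proof -
      let ?H = "g' j + (\<Sum>k\<in>Y. B j k * \<psi> k) + X1 ^ Suc (N - p) * G j"
      have "real N * ?n (\<psi> j) \<le> ?n ?H"
        unfolding wnorm_def sum_distrib_left
      proof (intro sum_mono)
        fix i l
        have "real N * norm (coeff2 (\<psi> j) i l) \<le> real (N + i) * norm (coeff2 (\<psi> j) i l)"
          by (intro mult_right_mono) auto
        also have "\<dots> = norm (coeff2 ?H i l)"
          unfolding key[OF j, symmetric] by (simp only: norm_mult norm_of_nat)
        finally show "real N * (norm (coeff2 (\<psi> j) i l) * s ^ (i + l)) \<le> norm (coeff2 ?H i l) * s ^ (i + l)"
          using mult_right_mono[of _ _ "s ^ (i + l)"] s_nn by (simp only: mult.assoc[symmetric] zero_le_power)
      qed
      also have "\<dots> \<le> ?n (g' j) + ?n (\<Sum>k\<in>Y. B j k * \<psi> k) + ?n (X1 ^ Suc (N - p) * G j)"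
        by (meson s_nn add_mono order_refl order_trans wnorm_add)
      also have "\<dots> \<le> g1 + (\<Sum>k\<in>Y. ?n (B j k)) * W (Suc I) J + s * K"
      proof (intro add_mono)
        show "?n (g' j) \<le> g1"
          using wnorm_mono_radius[OF s_nn s(2)] gb[OF J j] order_trans by blast
        show "?n (\<Sum>k\<in>Y. B j k * \<psi> k) \<le> (\<Sum>k\<in>Y. ?n (B j k)) * W (Suc I) J"
          unfolding sum_distrib_right using s_nn
          by (intro order_trans[OF wnorm_sum] sum_mono order_trans[OF wnorm_mult] mult_left_mono \<psi>W)
             (auto intro: wnorm_nonneg)
        have "?n (X1 ^ Suc (N - p) * G j) = wnorm s (1 + I) J (X1 ^ 1 * (X1 ^ (N - p) * G j))"
          by (simp add: mult.assoc)
        also have "\<dots> = s * wnorm s I J (X1 ^ (N - p) * G j)"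
          by (subst wnorm_X1_power_mult) simp
        also have "\<dots> \<le> s * (s ^ (N - p) * wnorm s I J (G j))"
          using s_nn by (intro mult_left_mono wnorm_X1_power_mult_le)
        also have "\<dots> \<le> s * (1 * wnorm s I J (G j))"
          using s_nn s_le by (intro mult_left_mono mult_right_mono power_le_one wnorm_nonneg)
        also have "\<dots> \<le> s * K"
          unfolding K_def c_def mult_1
          using s_nn s \<sigma> s\<sigma> P\<sigma>[OF s_nn s(2) J] order_trans[OF \<psi>W Suc.IH]
          by (intro mult_left_mono Gb[OF j]) auto
        finally show "?n (X1 ^ Suc (N - p) * G j) \<le> s * K" .
      qed
      finally show ?thesis .
    qed
    have W0: "0 \<le> W (Suc I) J" unfolding W_def using s_nn by (intro sum_nonneg wnorm_nonneg)
    have "real N * W (Suc I) J \<le> (\<Sum>j\<in>Y. g1 + (\<Sum>k\<in>Y. ?n (B j k)) * W (Suc I) J + s * K)"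
      unfolding W_def[of "Suc I" J] sum_distrib_left[of "real N"]
      using step unfolding W_def by (rule sum_mono)
    also have "\<dots> = n * g1 + (\<Sum>j\<in>Y. \<Sum>k\<in>Y. ?n (B j k)) * W (Suc I) J + s * (n * K)"
      by (simp add: sum.distrib n_def sum_distrib_right)
    also have "\<dots> \<le> n * g1 + (b0 + 1) * W (Suc I) J + 1"
    proof (intro add_mono order_refl mult_right_mono sK W0)
      have "(\<Sum>j\<in>Y. \<Sum>k\<in>Y. ?n (B j k)) \<le> (\<Sum>j\<in>Y. \<Sum>k\<in>Y. norm (coeff2 (B j k) 0 0) + s / s0 * b1)"
      proof (intro sum_mono)
        fix j k assume "j \<in> Y" "k \<in> Y"
        have "?n (B j k) \<le> norm (coeff2 (B j k) 0 0) + s / s0 * wnorm s0 (Suc I) J (B j k)"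
          using s s0 by (intro wnorm_le_constant_term_plus) auto
        also have "\<dots> \<le> norm (coeff2 (B j k) 0 0) + s / s0 * b1"
          using s s0 Bb1[OF J \<open>j \<in> Y\<close>] by (intro add_left_mono mult_left_mono) auto
        finally show "?n (B j k) \<le> norm (coeff2 (B j k) 0 0) + s / s0 * b1" .
      qed
      also have "\<dots> = b0 + s / s0 * (n * (n * b1))"
        using M_coeff[of "p - 1"] N p
        by (simp add: sum.distrib n_def b0_def B_def coeff2_shift mult_ac)
      also have "\<dots> \<le> b0 + 1" using sB by simp
      finally show "(\<Sum>j\<in>Y. \<Sum>k\<in>Y. ?n (B j k)) \<le> b0 + 1" .
    qed
    finally have "(real N - (b0 + 1)) * W (Suc I) J \<le> n * g1 + 1" by (simp add: algebra_simps)
    moreover have "1 * W (Suc I) J \<le> (real N - (b0 + 1)) * W (Suc I) J"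
      using Nb W0 by (intro mult_right_mono) auto
    ultimately show ?case by (simp add: w_def)
  qed

  have "wnorm s I J (\<Phi> k) \<le> \<sigma> + \<sigma>" if J: "J \<in> \<J>" for k I J
  proof -
    have "wnorm s I J (\<Phi> k) \<le> wnorm s I J (P k) + s ^ N * wnorm s I J (\<psi> k)"
      unfolding \<Phi> using s
      by (intro order_trans[OF wnorm_add] add_left_mono wnorm_X1_power_mult_le) auto
    also have "s ^ N * wnorm s I J (\<psi> k) \<le> s ^ N * w"
      using order_trans[OF \<psi>W W_bound[OF J]] s by (intro mult_left_mono) auto
    finally show ?thesis using P\<sigma>[OF _ s(2) J, of I k] s s\<sigma> by linarith
  qed
  then show ?thesis using s(1) by blast
qed

section \<open>Exchanging the two variables\<close>

text \<open>The exchange of \<open>x\<^sub>1\<close> and \<open>x\<^sub>2\<close> is a ring automorphism of \<open>\<complex>[[x\<^sub>1,x\<^sub>2]]\<close>; it turns the second equation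
  into one of the same form as the first.\<close>

definition swap_vars :: "series2 \<Rightarrow> series2"
  where "swap_vars F = Abs_fps (\<lambda>i. Abs_fps (\<lambda>j. coeff2 F j i))"

lemma coeff2_swap_vars [simp]: "coeff2 (swap_vars F) i j = coeff2 F j i"
  by (simp add: swap_vars_def coeff2_def)

lemma swap_vars_mult: "swap_vars (F * G) = swap_vars F * swap_vars G"
  by (intro series2_eqI, unfold coeff2_mult coeff2_swap_vars) (rule sum.swap)

lemma swap_vars_one: "swap_vars 1 = 1"
  by (intro series2_eqI) (auto simp: coeff2_def swap_vars_def)

lemma swap_vars_power: "swap_vars (F ^ n) = swap_vars F ^ n"
  by (induction n) (simp_all add: swap_vars_one swap_vars_mult)

lemma swap_vars_prod: "swap_vars (\<Prod>x\<in>A. F x) = (\<Prod>x\<in>A. swap_vars (F x))"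
  by (induction A rule: infinite_finite_induct) (simp_all add: swap_vars_one swap_vars_mult)

lemma coeff2_X1: "coeff2 X1 i j = (if i = 1 \<and> j = 0 then 1 else 0)"
  and coeff2_X2: "coeff2 X2 i j = (if i = 0 \<and> j = 1 then 1 else 0)"
  by (auto simp: coeff2_def X1_def X2_def fps_X_def)

lemma swap_vars_X2: "swap_vars X2 = X1"
  by (intro series2_eqI) (auto simp: coeff2_X1 coeff2_X2)

lemma swap_vars_deriv_x2: "swap_vars (deriv_x2 F) = deriv_x1 (swap_vars F)"
proof (intro series2_eqI)
  fix i j
  show "coeff2 (swap_vars (deriv_x2 F)) i j = coeff2 (deriv_x1 (swap_vars F)) i j"
    unfolding coeff2_deriv_x1 coeff2_swap_vars by (simp add: coeff2_def deriv_x2_def)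
qed

lemma formal_subst_swap_vars:
  "formal_subst a (\<lambda>k. swap_vars (\<Phi> k)) = swap_vars (formal_subst a \<Phi>)"
proof (intro series2_eqI)
  fix i j
  have "coeff2 (\<Prod>k\<in>UNIV. swap_vars (\<Phi> k) ^ \<alpha> k) i j = coeff2 (\<Prod>k\<in>UNIV. \<Phi> k ^ \<alpha> k) j i" for \<alpha>
    by (simp flip: swap_vars_power swap_vars_prod)
  then show "coeff2 (formal_subst a (\<lambda>k. swap_vars (\<Phi> k))) i j = coeff2 (swap_vars (formal_subst a \<Phi>)) i j"
    by (simp add: formal_subst_def coeff2_def swap_vars_def add.commute)
qed

lemma wnorm_swap_vars: "wnorm s I J (swap_vars F) = wnorm s J I F"
  unfolding wnorm_def by (subst sum.swap) (simp add: add.commute)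

section \<open>Convergence\<close>

lemma wnorm_cutoff_le:
  assumes "0 \<le> s"
  shows "wnorm s I J (fps_cutoff N F) \<le> wnorm s N J F"
proof -
  have "wnorm s I J (fps_cutoff N F) \<le> wnorm s (max I N) J (fps_cutoff N F)"
    using assms by (intro wnorm_mono) auto
  also have "\<dots> = wnorm s N J (fps_cutoff N F)"
    unfolding wnorm_def by (intro sum.mono_neutral_right) (auto simp: coeff2_cutoff)
  also have "\<dots> = wnorm s N J F"
    unfolding wnorm_def by (intro sum.cong refl) (simp add: coeff2_cutoff)
  finally show ?thesis .
qed

lemma summable_if_wnorm_bounded:
  assumes "\<And>I J. wnorm s I J F \<le> C" "norm x1 < s" "norm x2 < s"
  shows "(\<lambda>(k1, k2). coeff2 F k1 k2 * x1 ^ k1 * x2 ^ k2) summable_on UNIV"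
proof (rule abs_summable_summable)
  let ?f = "\<lambda>(k1, k2). coeff2 F k1 k2 * x1 ^ k1 * x2 ^ k2"
  have s: "0 \<le> s" using norm_ge_zero[of x1] assms(2) by linarith
  show "(\<lambda>k. norm (?f k)) summable_on UNIV"
  proof (rule nonneg_bdd_above_summable_on)
    show "bdd_above (sum (\<lambda>k. norm (?f k)) ` {S. S \<subseteq> UNIV \<and> finite S})"
    proof (rule bdd_aboveI2[of _ _ C])
      fix S :: "(nat \<times> nat) set" assume "S \<in> {S. S \<subseteq> UNIV \<and> finite S}"
      then have S: "finite S" by simp
      define n where "n = Suc (Max (insert 0 (fst ` S \<union> snd ` S)))"
      have "x < n" "y < n" if "(x, y) \<in> S" for x y
      proof -
        have "x \<in> fst ` S" "y \<in> snd ` S" using that by force+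
        then show "x < n" "y < n" using S by (auto simp: n_def less_Suc_eq_le)
      qed
      then have sub: "S \<subseteq> {..<n} \<times> {..<n}" by auto
      have "(\<Sum>k\<in>S. norm (?f k)) \<le> (\<Sum>k\<in>{..<n} \<times> {..<n}. norm (?f k))"
        using sub by (intro sum_mono2) auto
      also have "\<dots> \<le> (\<Sum>(i, j)\<in>{..<n} \<times> {..<n}. norm (coeff2 F i j) * s ^ (i + j))"
      proof (intro sum_mono, clarify)
        fix i j
        have "norm x1 ^ i * norm x2 ^ j \<le> s ^ i * s ^ j"
          using assms s by (intro mult_mono power_mono) auto
        then show "norm (coeff2 F i j * x1 ^ i * x2 ^ j) \<le> norm (coeff2 F i j) * s ^ (i + j)"
          by (simp add: norm_mult norm_power power_add mult.assoc mult_left_mono)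
      qed
      also have "\<dots> = wnorm s n n F"
        by (simp add: wnorm_def sum.cartesian_product)
      finally show "(\<Sum>k\<in>S. norm (?f k)) \<le> C" using assms(1)[of n n] by linarith
    qed
  qed simp
qed

lemma holomorphic_taylor_coeffs:
  fixes f :: "complex ^ 'm::finite \<Rightarrow> complex ^ 'n::finite"
  assumes "holomorphic_near_0 f"
  obtains A \<rho> where "0 < \<rho>"
    "\<And>j. geometric_bound A \<rho> (taylor_coeff (\<lambda>z. f z $ j))"
    "\<And>j k. taylor_coeff (partial k (\<lambda>z. f z $ j)) = partial_coeff k (taylor_coeff (\<lambda>z. f z $ j))"
proof -
  obtain R B where R: "0 < R" and F: "\<And>j. sep_holomorphic R (\<lambda>z. f z $ j)"
    and B: "\<And>j z. z \<in> polydisc R \<Longrightarrow> norm (f z $ j) \<le> B"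
    by (rule holomorphic_near_0_imp_sep_holomorphic[OF assms]) blast
  show ?thesis
  proof (rule that[of "R / 2 ^ CARD('m)" B])
    show "0 < R / 2 ^ CARD('m)" using R by simp
    show "geometric_bound B (R / 2 ^ CARD('m)) (taylor_coeff (\<lambda>z. f z $ j))" for j
      unfolding geometric_bound_def using taylor_coeff_bound[OF F B R] by blast
    show "taylor_coeff (partial k (\<lambda>z. f z $ j)) = partial_coeff k (taylor_coeff (\<lambda>z. f z $ j))" for j k
      by (simp add: fun_eq_iff taylor_coeff_partial[OF F R] partial_coeff_def incr_def)
  qed
qed

lemma point_on_Inr [simp]: "point_on \<phi> (Inr j) = \<phi> $ j"
  by (simp add: point_on_def)

lemma ord_ge_jacobian_on:
  assumes "ord_ge X q (jacobian_on f \<phi>)"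
  obtains G where "formal_subst (taylor_coeff (partial (Inr k) (\<lambda>z. f z $ j))) (point_on \<phi>) = X ^ q * G"
proof -
  obtain G :: "series2 ^ 'a ^ 'a" where "jacobian_on f \<phi> = (\<chi> a b. X ^ q * G $ a $ b)"
    using assms by (auto simp: ord_ge_def)
  then have "jacobian_on f \<phi> $ j $ k = X ^ q * G $ j $ k" by simp
  then show ?thesis by (intro that[of "G $ j $ k"]) (simp add: jacobian_on_def taylor_on_def)
qed

theorem theorem4:
  fixes f1 f2 :: "complex ^ (2 + 'n::finite) \<Rightarrow> complex ^ 'n"
    and \<phi> :: "series2 ^ 'n"
    and p1 p2 :: nat
  assumes "p1 \<ge> 1" and "p2 \<ge> 1"
    and "holomorphic_near_0 f1" and "f1 0 = 0"
    and "holomorphic_near_0 f2" and "f2 0 = 0"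
    and "formal_solution p1 p2 f1 f2 \<phi>"
    and "ord_ge X1 (p1 - 1) (jacobian_on f1 \<phi>)"
    and "ord_ge X2 (p2 - 1) (jacobian_on f2 \<phi>)"
  shows "converges_near_0 \<phi>"
proof -
  define \<Phi> where "\<Phi> = point_on \<phi>"
  define Y where "Y = range (Inr :: 'n \<Rightarrow> 2 + 'n)"
  (* For k outside Y, inv Inr yields an arbitrary component. *)
  define a where "a f k = taylor_coeff (\<lambda>z. f z $ (inv Inr k :: 'n))"
    for f :: "complex ^ (2 + 'n) \<Rightarrow> complex ^ 'n" and k :: "2 + 'n"
  have a_Inr: "a f (Inr j) = taylor_coeff (\<lambda>z. f z $ j)" for f j
    by (simp add: a_def)
  have coord: "\<Phi> k = X1 \<or> \<Phi> k = X2" if "k \<notin> Y" for k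
    using that by (cases k) (simp_all add: Y_def \<Phi>_def point_on_def)
  have \<Phi>0: "coeff2 (\<Phi> k) 0 0 = 0" for k
  proof (cases "k \<in> Y")
    case True
    then show ?thesis using assms(7) by (auto simp: Y_def \<Phi>_def formal_solution_def)
  next
    case False
    then show ?thesis using coord[of k] coeff2_X1[of 0 0] coeff2_X2[of 0 0] by auto
  qed
  have linear: "coeff2 (\<Phi> k) i j = 0" if "k \<notin> Y" "2 \<le> i \<or> 2 \<le> j" for k i j
    using coord[OF that(1)] that(2) coeff2_X1[of i j] coeff2_X2[of i j] by auto
  have eq1: "X1 ^ p1 * deriv_x1 (\<Phi> (Inr j)) = formal_subst (a f1 (Inr j)) \<Phi>"
    and eq2: "X2 ^ p2 * deriv_x2 (\<Phi> (Inr j)) = formal_subst (a f2 (Inr j)) \<Phi>" for j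
    using assms(7) by (auto simp: formal_solution_def taylor_on_def a_Inr \<Phi>_def)

  (* The second equation: for each M the coefficients of x1 ^ i with i < M are convergent series
     in x2, since the truncation in x1 makes the hypothesis on low orders a finite one. *)
  have slices: "\<exists>s>0. \<exists>C. \<forall>k. \<forall>J\<in>{M}. \<forall>I. wnorm s I J (swap_vars (\<Phi> k)) \<le> C" for M
  proof -
    obtain A \<rho> where \<rho>: "0 < \<rho>" and A: "\<And>j. geometric_bound A \<rho> (taylor_coeff (\<lambda>z. f2 z $ j))"
      and d: "\<And>j k. taylor_coeff (partial k (\<lambda>z. f2 z $ j)) =
        partial_coeff k (taylor_coeff (\<lambda>z. f2 z $ j))"
      by (rule holomorphic_taylor_coeffs[OF assms(5)]) blast
    show ?thesis
    proof (rule formal_solution_bounded[OF assms(2), where Y = Y and a = "a f2"])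
      fix j assume "j \<in> Y"
      then obtain j' where j: "j = Inr j'" by (auto simp: Y_def)
      show "X1 ^ p2 * deriv_x1 (swap_vars (\<Phi> j)) = formal_subst (a f2 j) (\<lambda>k. swap_vars (\<Phi> k))"
        unfolding formal_subst_swap_vars j eq2[symmetric]
        by (simp add: swap_vars_mult swap_vars_power swap_vars_X2 swap_vars_deriv_x2)
      show "geometric_bound A \<rho> (a f2 j)" by (simp add: j a_Inr A)
      fix k i l assume "k \<in> Y" and i: "i < p2 - 1"
      then obtain k' where k: "k = Inr k'" by (auto simp: Y_def)
      obtain G where "formal_subst (partial_coeff k (a f2 j)) \<Phi> = X2 ^ (p2 - 1) * G"
        using ord_ge_jacobian_on[OF assms(9), of k' j'] by (auto simp: \<Phi>_def j k a_Inr d)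
      then show "coeff2 (formal_subst (partial_coeff k (a f2 j)) (\<lambda>k. swap_vars (\<Phi> k))) i l = 0"
        using i unfolding formal_subst_swap_vars
        by (simp add: swap_vars_mult swap_vars_power swap_vars_X2 coeff2_X1_power_mult del: coeff2_swap_vars)
    next
      fix N
      have "wnorm 1 I J (fps_cutoff N (swap_vars (\<Phi> k))) \<le> (\<Sum>k\<in>UNIV. wnorm 1 N M (swap_vars (\<Phi> k)))"
        if "J \<in> {M}" for I J k
      proof -
        have "wnorm 1 I J (fps_cutoff N (swap_vars (\<Phi> k))) \<le> wnorm 1 N M (swap_vars (\<Phi> k))"
          using wnorm_cutoff_le[of 1] that by simp
        also have "\<dots> \<le> (\<Sum>k\<in>UNIV. wnorm 1 N M (swap_vars (\<Phi> k)))"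
          by (rule member_le_sum) (auto intro: wnorm_nonneg)
        finally show ?thesis .
      qed
      then show "\<exists>s>0. \<exists>C. \<forall>k. \<forall>J\<in>{M}. \<forall>I. wnorm s I J (fps_cutoff N (swap_vars (\<Phi> k))) \<le> C"
        by (intro exI[of _ 1]) auto
    qed (use \<Phi>0 \<rho> linear in auto)
  qed

  (* The first equation, whose hypothesis on low orders in x1 is the convergence just obtained. *)
  have "\<exists>s>0. \<exists>C. \<forall>k. \<forall>J\<in>UNIV. \<forall>I. wnorm s I J (\<Phi> k) \<le> C"
  proof -
    obtain A \<rho> where \<rho>: "0 < \<rho>" and A: "\<And>j. geometric_bound A \<rho> (taylor_coeff (\<lambda>z. f1 z $ j))"
      and d: "\<And>j k. taylor_coeff (partial k (\<lambda>z. f1 z $ j)) =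
        partial_coeff k (taylor_coeff (\<lambda>z. f1 z $ j))"
      by (rule holomorphic_taylor_coeffs[OF assms(3)]) blast
    show ?thesis
    proof (rule formal_solution_bounded[OF assms(1), where Y = Y and a = "a f1"])
      fix j assume "j \<in> Y"
      then obtain j' where j: "j = Inr j'" by (auto simp: Y_def)
      show "X1 ^ p1 * deriv_x1 (\<Phi> j) = formal_subst (a f1 j) \<Phi>"
        unfolding j by (rule eq1)
      show "geometric_bound A \<rho> (a f1 j)" by (simp add: j a_Inr A)
      fix k i l assume "k \<in> Y" and i: "i < p1 - 1"
      then obtain k' where k: "k = Inr k'" by (auto simp: Y_def)
      obtain G where "formal_subst (partial_coeff k (a f1 j)) \<Phi> = X1 ^ (p1 - 1) * G"
        using ord_ge_jacobian_on[OF assms(8), of k' j'] by (auto simp: \<Phi>_def j k a_Inr d)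
      then show "coeff2 (formal_subst (partial_coeff k (a f1 j)) \<Phi>) i l = 0"
        using i by (simp add: coeff2_X1_power_mult)
    next
      fix N
      obtain s C where s: "0 < s" and C: "\<And>k I. wnorm s I N (swap_vars (\<Phi> k)) \<le> C"
        using slices[of N] by blast
      have "wnorm s I J (fps_cutoff N (\<Phi> k)) \<le> C" for k I J
        using wnorm_cutoff_le[of s I J N "\<Phi> k"] C[of J k] s by (simp add: wnorm_swap_vars)
      then show "\<exists>s>0. \<exists>C. \<forall>k. \<forall>J\<in>UNIV. \<forall>I. wnorm s I J (fps_cutoff N (\<Phi> k)) \<le> C"
        using s by blast
    qed (use \<Phi>0 \<rho> linear in auto)
  qed
  then obtain s C where s: "0 < s" and C: "\<And>k I J. wnorm s I J (\<Phi> k) \<le> C"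
    by blast
  have "(\<lambda>(k1, k2). coeff2 (\<phi> $ j) k1 k2 * x1 ^ k1 * x2 ^ k2) summable_on UNIV"
    if "norm x1 < s" "norm x2 < s" for x1 x2 j
    using summable_if_wnorm_bounded[OF C that, of "Inr j"] by (simp add: \<Phi>_def)
  then show ?thesis
    unfolding converges_near_0_def using s by blast
qed

end
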